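(* Let $(n_i)_{i\ge0}$, $(\widehat n_i)_{i\ge0}$ be sequences of positive integers with $n_i\le\widehat n_i$ for all $i\ge0$, and let $M\le\widehat M$ be the corresponding multiplicative matrix sequences (nested circle rotations). Let $\nu$ denote the unique central measure for $\Sigma_M^{0,+}$, with $\mathbf w\in\mathcal V_M^\Delta$ the corresponding eigenvector sequence, and write $\widehat\nu$ for its extension to the adic tower $\Sigma_{\widehat M/M}^{0,+}$ and for the corresponding $R_{\widehat\theta}$-invariant Borel measure on the circle. Write $\lambda_i=([n_in_{i+1}\dots])^{-1}$, $\lambda_0^n=\lambda_0\lambda_1\cdots\lambda_n$, and similarly $\widehat\lambda_i,\widehat\lambda_0^n$ for $\widehat n$. Then the tower measure $\widehat\nu$ is inner regular; it is finite iff $\liminf_n\|\widehat M_0^n\mathbf w_{n+1}\|<\infty$, and that holds iff $\liminf_n\widehat\lambda_0^n/\lambda_0^n<\infty$. When the measure is infinite, it is infinite on every (nonempty) open subset of $\Sigma_{\widehat M}^{0,+}$ (and of the circle), hence is not Radon.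
   Context: **Multiplicative family.** All alphabets are $\mathcal A_i=\{A,B\}$, and (rows and columns in the order $A,B$) $$M_i=\begin{bmatrix}1&0\\ n_i&1\end{bmatrix}\ (i\text{ even}),\qquad M_i=\begin{bmatrix}1&n_i\\ 0&1\end{bmatrix}\ (i\text{ odd}),$$ and $\widehat M_i$ is defined likewise from $\widehat n_i$. $M_0^n=M_0M_1\cdots M_n$. $[n_0n_1\dots]=\cfrac1{n_0+\cfrac1{n_1+\cdots}}$. **Path space.** The Bratteli diagram has $(M_i)_{ab}$ edges $e$ from $e^-=a\in\mathcal A_i$ to $e^+=b\in\mathcal A_{i+1}$; $\Sigma_M^{0,+}$ is the space of infinite edge paths $(.e_0e_1\dots)$ with the product topology. Since $M_i\le\widehat M_i$ entrywise, the edge sets are taken nested, $\mathcal E_i\subseteq\widehat{\mathcal E}_i$, and $\Sigma_M^{0,+}\subseteq\Sigma_{\widehat M}^{0,+}$. $\mathcal{FC}_M$ is the group of homeomorphisms generated by the involutions interchanging two thin cylinders $[.e_0\dots e_n]$, $[.f_0\dots f_n]$ (paths with these initial edges) with $e_n^+=f_n^+$, leaving tails unchanged and fixing all other points. A central measure is an $\mathcal{FC}_M$-invariant Borel probability measure. $\mathcal V_M^\Delta$ is the set of sequences $\mathbf w=(\mathbf w_i)_{i\ge0}$ of nonzero nonnegative vectors in $\mathbb R^2$ with $\mathbf w_i=M_i\mathbf w_{i+1}$ and $\|\mathbf w_0\|=1$ ($L^1$-norm); the measure corresponding to $\mathbf w$ satisfies $\nu([.e_0\dots e_{n-1}])=(\mathbf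 w_n)_s$, $s=e_{n-1}^+$. **Tower.** $\Sigma_{\widehat M/M}^{0,+}$ is the set of paths in $\Sigma_{\widehat M}^{0,+}$ with $e_i\in\mathcal E_i$ for all but finitely many $i$. The extension $\widehat\nu$ is the unique $\mathcal{FC}_{\widehat M}$-invariant Borel measure on the tower restricting to $\nu$ on $\Sigma_M^{0,+}$, extended by zero to $\Sigma_{\widehat M}^{0,+}$. **Rotation.** Let $\rho_i$ be the substitution $A\mapsto AB^{\widehat n_i}$, $B\mapsto B$ for $i$ even, and $A\mapsto A$, $B\mapsto A^{\widehat n_i}B$ for $i$ odd. Order the edges entering $b\in\mathcal A_{i+1}$ according to the word $\rho_i(b)$ (whose letters are the initial symbols of these edges), and order paths with equal tails anti-lexicographically (by the last coordinate in which they differ). The adic transformation $T$ sends a path to its successor. It is isomorphic to the rotation $R_{\widehat\theta}:x\mapsto x+\widehat\theta$ of the circle $\mathbb R/\mathbb Z$, $\widehat\theta=\widehat\alpha/(1+\widehat\alpha)$, $\widehat\alpha=[\widehat n_0\widehat n_1\dots]$, via the standard coding: a continuous surjection $\pi$ of $\Sigma_{\widehat M}^{0,+}$ onto the circle, injective off a countable set, conjugating $T$ to $R_{\widehat\theta}$ where $T$ is defined. The corresponding measure on the circle is the image of $\widehat\nu$ under $\pi$. **Regularity.** A Borel measure is inner regular if the measure of each Borel set is the supremum of the measures of its compact subsets; locally finite if each point has a neighborhood of finite measure; Radon if it is both. *)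

theory Defs
  imports "HOL-Probability.Probability_Measure"
begin

datatype letter = A | B

instance letter :: finite
proof
  have "UNIV = {A, B}" using letter.exhaust by auto
  then show "finite (UNIV :: letter set)" by (metis finite.emptyI finite.insertI)
qed

fun mult_entry :: "(nat \<Rightarrow> nat) \<Rightarrow> nat \<Rightarrow> letter \<Rightarrow> letter \<Rightarrow> nat" where
  "mult_entry n i A A = 1"
| "mult_entry n i A B = (if even i then 0 else n i)"
| "mult_entry n i B A = (if even i then n i else 0)"
| "mult_entry n i B B = 1"

definition mult_mat :: "(nat \<Rightarrow> nat) \<Rightarrow> nat \<Rightarrow> real^letter^letter" where
  "mult_mat n i = (\<chi> a b. real (mult_entry n i a b))"

text \<open>\<open>mat_prod n k\<close> has the \<open>k + 1\<close> factors with indices \<open>0, \<dots>, k\<close>.\<close>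

primrec mat_prod :: "(nat \<Rightarrow> nat) \<Rightarrow> nat \<Rightarrow> real^letter^letter" where
  "mat_prod n 0 = mult_mat n 0"
| "mat_prod n (Suc k) = mat_prod n k ** mult_mat n (Suc k)"

definition l1norm :: "real^letter \<Rightarrow> real" where
  "l1norm v = (\<Sum>a\<in>UNIV. \<bar>v $ a\<bar>)"

text \<open>The continued fraction \<open>1/(n\<^sub>0 + 1/(n\<^sub>1 + \<dots>))\<close>, as the limit of its truncations to
  \<open>k\<close> terms.\<close>

primrec cfrac_trunc :: "nat \<Rightarrow> (nat \<Rightarrow> nat) \<Rightarrow> real" where
  "cfrac_trunc 0 n = 0"
| "cfrac_trunc (Suc k) n = 1 / (real (n 0) + cfrac_trunc k (\<lambda>i. n (Suc i)))"

definition cfrac :: "(nat \<Rightarrow> nat) \<Rightarrow> real" where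
  "cfrac n = lim (\<lambda>k. cfrac_trunc k n)"

definition lam :: "(nat \<Rightarrow> nat) \<Rightarrow> nat \<Rightarrow> real" where
  "lam n i = inverse (cfrac (\<lambda>j. n (i + j)))"

definition lam_prod :: "(nat \<Rightarrow> nat) \<Rightarrow> nat \<Rightarrow> real" where
  "lam_prod n k = (\<Prod>i\<le>k. lam n i)"

text \<open>The third component numbers the parallel edges between two given symbols.\<close>

datatype edge = Edge (src: letter) (tgt: letter) (idx: nat)

type_synonym path = "nat \<Rightarrow> edge"

definition edges :: "(nat \<Rightarrow> nat) \<Rightarrow> nat \<Rightarrow> edge set" where
  "edges n i = {e. idx e < mult_entry n i (src e) (tgt e)}"

text \<open>An edge system for the matrix sequence of \<open>n\<close>, nested in that of \<open>nh\<close>. Which of the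
  parallel edges are kept is left arbitrary.\<close>

definition nested_edges :: "(nat \<Rightarrow> nat) \<Rightarrow> (nat \<Rightarrow> nat) \<Rightarrow> (nat \<Rightarrow> edge set) \<Rightarrow> bool" where
  "nested_edges n nh E \<longleftrightarrow> (\<forall>i. E i \<subseteq> edges nh i \<and>
     (\<forall>a b. card {e \<in> E i. src e = a \<and> tgt e = b} = mult_entry n i a b))"

definition paths :: "(nat \<Rightarrow> edge set) \<Rightarrow> path set" where
  "paths E = {x. \<forall>i. x i \<in> E i \<and> tgt (x i) = src (x (Suc i))}"

definition path_top :: "(nat \<Rightarrow> edge set) \<Rightarrow> path topology" where
  "path_top E = subtopology (product_topology (\<lambda>i. discrete_topology (E i)) UNIV) (paths E)"

definition finite_path :: "(nat \<Rightarrow> edge set) \<Rightarrow> edge list \<Rightarrow> bool" where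
  "finite_path E p \<longleftrightarrow> p \<noteq> [] \<and> (\<forall>i<length p. p ! i \<in> E i) \<and>
     (\<forall>i. Suc i < length p \<longrightarrow> tgt (p ! i) = src (p ! Suc i))"

definition cyl :: "(nat \<Rightarrow> edge set) \<Rightarrow> edge list \<Rightarrow> path set" where
  "cyl E p = {x \<in> paths E. \<forall>i<length p. x i = p ! i}"

definition replace_init :: "edge list \<Rightarrow> path \<Rightarrow> path" where
  "replace_init p x = (\<lambda>i. if i < length p then p ! i else x i)"

definition swap_cyl :: "(nat \<Rightarrow> edge set) \<Rightarrow> edge list \<Rightarrow> edge list \<Rightarrow> path \<Rightarrow> path" where
  "swap_cyl E p q x = (if x \<in> cyl E p then replace_init q x
     else if x \<in> cyl E q then replace_init p x else x)"

text \<open>The generators are involutions, so closing under composition yields the generated group.\<close>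

inductive_set FC :: "(nat \<Rightarrow> edge set) \<Rightarrow> (path \<Rightarrow> path) set" for E where
  FC_id: "id \<in> FC E"
| FC_swap: "g \<in> FC E \<Longrightarrow> finite_path E p \<Longrightarrow> finite_path E q \<Longrightarrow> length p = length q \<Longrightarrow>
     tgt (last p) = tgt (last q) \<Longrightarrow> swap_cyl E p q \<circ> g \<in> FC E"

definition borel_of :: "'a topology \<Rightarrow> 'a measure" where
  "borel_of X = sigma (topspace X) {U. openin X U}"

definition FC_invariant :: "(nat \<Rightarrow> edge set) \<Rightarrow> path measure \<Rightarrow> bool" where
  "FC_invariant E \<mu> \<longleftrightarrow> (\<forall>g\<in>FC E. \<forall>S\<in>sets \<mu>. emeasure \<mu> (g ` S) = emeasure \<mu> S)"

definition central_measure :: "(nat \<Rightarrow> edge set) \<Rightarrow> path measure \<Rightarrow> bool" where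
  "central_measure E \<nu> \<longleftrightarrow>
     sets \<nu> = sets (borel_of (path_top E)) \<and> prob_space \<nu> \<and> FC_invariant E \<nu>"

definition eigen_sequences :: "(nat \<Rightarrow> nat) \<Rightarrow> (nat \<Rightarrow> real^letter) set" where
  "eigen_sequences n = {w. (\<forall>i. w i \<noteq> 0 \<and> (\<forall>a. 0 \<le> w i $ a) \<and> w i = mult_mat n i *v w (Suc i))
     \<and> l1norm (w 0) = 1}"

definition corresponds :: "(nat \<Rightarrow> edge set) \<Rightarrow> path measure \<Rightarrow> (nat \<Rightarrow> real^letter) \<Rightarrow> bool" where
  "corresponds E \<nu> w \<longleftrightarrow>
     (\<forall>p. finite_path E p \<longrightarrow> emeasure \<nu> (cyl E p) = ennreal (w (length p) $ tgt (last p)))"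

definition tower :: "(nat \<Rightarrow> edge set) \<Rightarrow> (nat \<Rightarrow> edge set) \<Rightarrow> path set" where
  "tower Eh E = {x \<in> paths Eh. finite {i. x i \<notin> E i}}"

text \<open>\<open>\<mu>\<close> lives on the whole path space of \<open>Eh\<close>; extension by zero means that the complement of
  the tower is null.\<close>

definition tower_extension ::
    "(nat \<Rightarrow> edge set) \<Rightarrow> (nat \<Rightarrow> edge set) \<Rightarrow> path measure \<Rightarrow> path measure \<Rightarrow> bool" where
  "tower_extension Eh E \<nu> \<mu> \<longleftrightarrow>
     sets \<mu> = sets (borel_of (path_top Eh)) \<and> FC_invariant Eh \<mu> \<and>
     (\<forall>S\<in>sets \<nu>. emeasure \<mu> S = emeasure \<nu> S) \<and>
     emeasure \<mu> (paths Eh - tower Eh E) = 0"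

definition inner_regular_in :: "'a topology \<Rightarrow> 'a measure \<Rightarrow> bool" where
  "inner_regular_in X \<mu> \<longleftrightarrow>
     (\<forall>S\<in>sets \<mu>. emeasure \<mu> S = (SUP K\<in>{K. compactin X K \<and> K \<subseteq> S}. emeasure \<mu> K))"

definition locally_finite_in :: "'a topology \<Rightarrow> 'a measure \<Rightarrow> bool" where
  "locally_finite_in X \<mu> \<longleftrightarrow>
     (\<forall>x\<in>topspace X. \<exists>U. openin X U \<and> x \<in> U \<and> emeasure \<mu> U < \<infinity>)"

definition radon_in :: "'a topology \<Rightarrow> 'a measure \<Rightarrow> bool" where
  "radon_in X \<mu> \<longleftrightarrow> inner_regular_in X \<mu> \<and> locally_finite_in X \<mu>"

quotient_type circle = real / "\<lambda>x y :: real. x - y \<in> \<int>"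
proof (rule equivpI)
  show "reflp (\<lambda>x y :: real. x - y \<in> \<int>)" by (auto intro: reflpI)
  show "symp (\<lambda>x y :: real. x - y \<in> \<int>)" by (rule sympI) (metis Ints_minus minus_diff_eq)
  show "transp (\<lambda>x y :: real. x - y \<in> \<int>)"
    by (rule transpI) (metis Ints_add diff_add_cancel add_diff_eq)
qed

instantiation circle :: topological_space
begin

definition open_circle :: "circle set \<Rightarrow> bool" where
  "open_circle U \<longleftrightarrow> open (abs_circle -` U)"

instance
  by standard (auto simp: open_circle_def vimage_Union)

end

lift_definition rotate_circle :: "real \<Rightarrow> circle \<Rightarrow> circle" is "\<lambda>t x. x + t"
  by simp

fun subst_word :: "(nat \<Rightarrow> nat) \<Rightarrow> nat \<Rightarrow> letter \<Rightarrow> letter list" where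
  "subst_word nh i A = (if even i then A # replicate (nh i) B else [A])"
| "subst_word nh i B = (if even i then [B] else replicate (nh i) A @ [B])"

text \<open>The edge with source \<open>a\<close> and number \<open>k\<close> entering \<open>b\<close> is matched with the occurrence of \<open>a\<close> in
  the word of \<open>b\<close> that is preceded by exactly \<open>k\<close> others.\<close>

definition edge_pos :: "(nat \<Rightarrow> nat) \<Rightarrow> nat \<Rightarrow> edge \<Rightarrow> nat" where
  "edge_pos nh i e = (THE j. j < length (subst_word nh i (tgt e)) \<and>
     subst_word nh i (tgt e) ! j = src e \<and>
     count_list (take j (subst_word nh i (tgt e))) (src e) = idx e)"

definition edge_less :: "(nat \<Rightarrow> nat) \<Rightarrow> nat \<Rightarrow> edge \<Rightarrow> edge \<Rightarrow> bool" where
  "edge_less nh i e f \<longleftrightarrow> tgt e = tgt f \<and> edge_pos nh i e < edge_pos nh i f"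

definition path_less :: "(nat \<Rightarrow> nat) \<Rightarrow> path \<Rightarrow> path \<Rightarrow> bool" where
  "path_less nh x y \<longleftrightarrow> (\<exists>i. (\<forall>j>i. x j = y j) \<and> edge_less nh i (x i) (y i))"

text \<open>The adic transformation is a partial map, given here by its graph: \<open>y\<close> is the successor
  of \<open>x\<close>.\<close>

definition adic_succ :: "(nat \<Rightarrow> nat) \<Rightarrow> path \<Rightarrow> path \<Rightarrow> bool" where
  "adic_succ nh x y \<longleftrightarrow> x \<in> paths (edges nh) \<and> y \<in> paths (edges nh) \<and> path_less nh x y \<and>
     \<not> (\<exists>z\<in>paths (edges nh). path_less nh x z \<and> path_less nh z y)"

definition rot_angle :: "(nat \<Rightarrow> nat) \<Rightarrow> real" where
  "rot_angle nh = cfrac nh / (1 + cfrac nh)"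

definition standard_coding :: "(nat \<Rightarrow> nat) \<Rightarrow> (path \<Rightarrow> circle) \<Rightarrow> bool" where
  "standard_coding nh \<pi> \<longleftrightarrow>
     continuous_map (path_top (edges nh)) euclidean \<pi> \<and>
     \<pi> ` paths (edges nh) = UNIV \<and>
     (\<exists>C. countable C \<and> inj_on \<pi> (paths (edges nh) - C)) \<and>
     (\<forall>x y. adic_succ nh x y \<longrightarrow> \<pi> y = rotate_circle (rot_angle nh) (\<pi> x))"

end

theory Submission
  imports Defs "HOL-Analysis.Regularity"
begin

text \<open>
  Write \<open>L\<^sub>k = {x. x\<^sub>i \<in> E\<^sub>i for i > k}\<close> for the levels of the tower. A cylinder of length \<open>k + 1\<close>
  ending in \<open>b\<close> meets \<open>L\<^sub>k\<close> in a set which a swap carries to a cylinder of the small path space, so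
  the tower measure of the intersection is \<open>(w\<^sub>k\<^sub>+\<^sub>1)\<^sub>b\<close>. The number of these cylinders is the \<open>b\<close>-th
  column sum of the product \<open>P\<^sub>k\<close> of the larger matrices with indices \<open>0, \<dots>, k\<close>, hence
  \<open>L\<^sub>k\<close> has measure \<open>\<parallel>P\<^sub>k w\<^sub>k\<^sub>+\<^sub>1\<parallel>\<close> (\<open>emeasure_level\<close>). The levels increase to the tower, so the total
  mass is the limit of these increasing norms, and it is finite iff their lower limit is
  (\<open>finite_measure_iff\<close>).

  The levels exhibit the tower measure as \<open>\<sigma>\<close>-finite. The path space is compact and embeds in a
  Polish space, where finite Borel measures are inner regular. Restricting to one level at a time
  transfers this to the tower measure (\<open>inner_regular_in_sigma_finite\<close>).

  For the comparison with \<open>\<lambda>\<close>, the ratio of the two coordinates of \<open>w\<^sub>k\<close> is forced to be the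
  continued fraction of the \<open>k\<close>-th tail of \<open>n\<close>. Thus \<open>w\<^sub>k\<^sub>+\<^sub>1\<close> is a constant divided by
  \<open>\<lambda>\<^sub>0 \<cdots> \<lambda>\<^sub>k\<close>, times a vector \<open>(1, r)\<close> with \<open>0 \<le> r \<le> 1\<close>. For the
  larger sequence the corresponding vector \<open>(1, r')\<close> is multiplied by \<open>P\<^sub>k\<close> to a fixed vector times
  \<open>\<lambda>'\<^sub>0 \<cdots> \<lambda>'\<^sub>k\<close>, where \<open>r'\<close> and \<open>\<lambda>'\<close> belong to that sequence. As the column of \<open>P\<^sub>k\<close> belonging to
  the coordinate \<open>1\<close> has the larger sum, \<open>\<parallel>P\<^sub>k (1, r)\<parallel>\<close> and \<open>\<parallel>P\<^sub>k (1, r')\<parallel>\<close>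
  differ by a factor of at most two (\<open>l1norm_eigen_sequence_comparable\<close>).

  If the mass is infinite, then for every length some cylinder has infinite measure. The product of
  two consecutive matrices has positive entries, so every cylinder contains one that is two steps
  longer and ends in any prescribed letter. By invariance it has the same measure as the
  infinite one (\<open>emeasure_cyl_infinite\<close>). The statements on the circle follow by pushing compact
  sets forward and pulling open sets back, as the circle is Hausdorff and the coding is continuous
  and onto.
\<close>

section \<open>Continued fractions\<close>

text \<open>With the tail after \<open>k\<close> terms as an argument, truncations and exact values are values of the same
  map, and its contraction gives both existence and uniqueness.\<close>

primrec cfrac_with_tail :: "nat \<Rightarrow> (nat \<Rightarrow> nat) \<Rightarrow> real \<Rightarrow> real" where
  "cfrac_with_tail 0 n x = x"
| "cfrac_with_tail (Suc k) n x = 1 / (real (n 0) + cfrac_with_tail k (\<lambda>i. n (Suc i)) x)"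

lemma cfrac_with_tail_nonneg: "0 \<le> x \<Longrightarrow> 0 \<le> cfrac_with_tail k n x"
  by (induction k arbitrary: n) auto

lemma cfrac_trunc_add:
  "cfrac_trunc (k + m) n = cfrac_with_tail k n (cfrac_trunc m (\<lambda>i. n (k + i)))"
  by (induction k arbitrary: n) auto

text \<open>A single step \<open>x \<mapsto> 1 / (a + x)\<close> may have slope 1 at \<open>x = 0\<close>. Two steps give a fraction with
  denominator \<open>a (b + x) + 1 \<ge> 2\<close>.\<close>

lemma cfrac_two_step_contraction:
  fixes a b x y :: real
  assumes "1 \<le> a" "1 \<le> b" "0 \<le> x" "0 \<le> y"
  shows "\<bar>1 / (a + 1 / (b + x)) - 1 / (a + 1 / (b + y))\<bar> \<le> \<bar>x - y\<bar> / 4"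
proof -
  have frac: "1 / (a + 1 / (b + z)) = (b + z) / (a * (b + z) + 1)" if "0 \<le> z" for z
    using that assms by (simp add: divide_simps)
  have ge: "2 \<le> a * (b + z) + 1" if "0 \<le> z" for z
    using that assms mult_mono[of 1 a 1 "b + z"] by simp
  define p where "p = a * (b + x) + 1"
  define q where "q = a * (b + y) + 1"
  have p: "2 \<le> p" and q: "2 \<le> q" using ge assms unfolding p_def q_def by auto
  have "4 \<le> p * q" using mult_mono[of 2 p 2 q] p q by simp
  have "1 / (a + 1 / (b + x)) - 1 / (a + 1 / (b + y)) = (b + x) / p - (b + y) / q"
    using frac assms unfolding p_def q_def by simp
  also have "\<dots> = ((b + x) * q - (b + y) * p) / (p * q)"
    using p q by (simp add: field_simps)
  also have "(b + x) * q - (b + y) * p = x - y"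
    unfolding p_def q_def by (simp add: algebra_simps)
  finally have "\<bar>1 / (a + 1 / (b + x)) - 1 / (a + 1 / (b + y))\<bar> = \<bar>x - y\<bar> / (p * q)"
    using \<open>4 \<le> p * q\<close> by (simp only: abs_divide abs_of_nonneg)
  also have "\<dots> \<le> \<bar>x - y\<bar> / 4"
    using \<open>4 \<le> p * q\<close> by (intro divide_left_mono) auto
  finally show ?thesis .
qed

lemma cfrac_with_tail_contraction:
  assumes "\<And>i. 1 \<le> n i" "0 \<le> x" "0 \<le> y"
  shows "\<bar>cfrac_with_tail (2 * j) n x - cfrac_with_tail (2 * j) n y\<bar> \<le> (1 / 4) ^ j * \<bar>x - y\<bar>"
  using assms(1)
proof (induction j arbitrary: n)
  case (Suc j)
  let ?F = "cfrac_with_tail (2 * j) (\<lambda>i. n (Suc (Suc i)))"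
  have n: "1 \<le> real (n 0)" "1 \<le> real (n (Suc 0))"
    using Suc.prems[of 0] Suc.prems[of "Suc 0"] by auto
  have "\<bar>cfrac_with_tail (2 * Suc j) n x - cfrac_with_tail (2 * Suc j) n y\<bar> \<le> \<bar>?F x - ?F y\<bar> / 4"
    using cfrac_two_step_contraction[OF n cfrac_with_tail_nonneg cfrac_with_tail_nonneg] assms by simp
  also have "\<dots> \<le> (1 / 4) ^ Suc j * \<bar>x - y\<bar>"
    using Suc.IH[of "\<lambda>i. n (Suc (Suc i))"] Suc.prems by simp
  finally show ?case .
qed simp

lemma cfrac_trunc_bounds:
  assumes "\<And>i. 1 \<le> n i"
  shows "0 \<le> cfrac_trunc k n \<and> cfrac_trunc k n \<le> 1"
  using assms
proof (induction k arbitrary: n)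
  case (Suc k)
  have "0 \<le> cfrac_trunc k (\<lambda>i. n (Suc i))"
    by (rule conjunct1[OF Suc.IH]) (rule Suc.prems)
  moreover have "1 \<le> real (n 0)" using Suc.prems[of 0] by simp
  ultimately have "1 \<le> real (n 0) + cfrac_trunc k (\<lambda>i. n (Suc i))" by linarith
  then show ?case unfolding cfrac_trunc.simps by (simp add: divide_le_eq_1)
next
  case 0
  show ?case by simp
qed

text \<open>Truncations sharing their first \<open>2j\<close> terms differ only in tails lying in \<open>[0, 1]\<close>.\<close>

lemma cfrac_trunc_LIMSEQ:
  assumes n: "\<And>i. 1 \<le> n i"
  shows "(\<lambda>k. cfrac_trunc k n) \<longlonglongrightarrow> cfrac n"
proof -
  have "Cauchy (\<lambda>k. cfrac_trunc k n)"
  proof (rule metric_CauchyI)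
    fix e :: real assume "0 < e"
    then obtain j where j: "(1 / 4) ^ j < e"
      using real_arch_pow_inv[of e "1/4"] by auto
    have "dist (cfrac_trunc k n) (cfrac_trunc l n) < e" if "2 * j \<le> k" "2 * j \<le> l" for k l
    proof -
      let ?t = "\<lambda>m. cfrac_trunc (m - 2 * j) (\<lambda>i. n (2 * j + i))"
      have t: "cfrac_trunc m n = cfrac_with_tail (2 * j) n (?t m)" if "2 * j \<le> m" for m
        using that cfrac_trunc_add[of "2 * j" "m - 2 * j" n] by simp
      have b: "0 \<le> ?t m \<and> ?t m \<le> 1" for m by (rule cfrac_trunc_bounds) (rule n)
      have "\<bar>cfrac_trunc k n - cfrac_trunc l n\<bar> \<le> (1 / 4) ^ j * \<bar>?t k - ?t l\<bar>"
        unfolding t[OF that(1)] t[OF that(2)]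
        by (rule cfrac_with_tail_contraction) (use n b in auto)
      also have "\<dots> \<le> (1 / 4) ^ j * 1"
        using conjunct1[OF b[of k]] conjunct2[OF b[of k]] conjunct1[OF b[of l]] conjunct2[OF b[of l]]
        by (intro mult_left_mono) (linarith, simp)
      finally show ?thesis using j by (simp add: dist_real_def)
    qed
    then show "\<exists>M. \<forall>k\<ge>M. \<forall>l\<ge>M. dist (cfrac_trunc k n) (cfrac_trunc l n) < e" by blast
  qed
  then have "convergent (\<lambda>k. cfrac_trunc k n)" by (rule Cauchy_convergent)
  then show ?thesis unfolding cfrac_def convergent_LIMSEQ_iff .
qed

lemma cfrac_bounds:
  assumes "\<And>i. 1 \<le> n i"
  shows "0 \<le> cfrac n" "cfrac n \<le> 1"
proof -
  have b: "0 \<le> cfrac_trunc k n \<and> cfrac_trunc k n \<le> 1" for k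
    by (rule cfrac_trunc_bounds) (rule assms)
  have lim: "(\<lambda>k. cfrac_trunc k n) \<longlonglongrightarrow> cfrac n"
    by (rule cfrac_trunc_LIMSEQ) (rule assms)
  show "0 \<le> cfrac n" using lim by (rule LIMSEQ_le_const) (use b in blast)
  show "cfrac n \<le> 1" using lim by (rule LIMSEQ_le_const2) (use b in blast)
qed

lemma cfrac_rec:
  assumes "\<And>i. 1 \<le> n i"
  shows "cfrac n = 1 / (real (n 0) + cfrac (\<lambda>i. n (Suc i)))"
proof -
  have lim: "(\<lambda>k. cfrac_trunc k (\<lambda>i. n (Suc i))) \<longlonglongrightarrow> cfrac (\<lambda>i. n (Suc i))"
    by (rule cfrac_trunc_LIMSEQ) (rule assms)
  have "0 \<le> cfrac (\<lambda>i. n (Suc i))" by (rule cfrac_bounds) (rule assms)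
  then have "real (n 0) + cfrac (\<lambda>i. n (Suc i)) \<noteq> 0" using assms[of 0] by linarith
  then have "(\<lambda>k. cfrac_trunc (Suc k) n) \<longlonglongrightarrow> 1 / (real (n 0) + cfrac (\<lambda>i. n (Suc i)))"
    unfolding cfrac_trunc.simps
    by (intro tendsto_divide tendsto_add tendsto_const lim)
  moreover have "(\<lambda>k. cfrac_trunc (Suc k) n) \<longlonglongrightarrow> cfrac n"
    by (rule LIMSEQ_Suc[OF cfrac_trunc_LIMSEQ]) (rule assms)
  ultimately show ?thesis by (rule LIMSEQ_unique[THEN sym])
qed

abbreviation (input) cfrac_from :: "(nat \<Rightarrow> nat) \<Rightarrow> nat \<Rightarrow> real" where
  "cfrac_from n i \<equiv> cfrac (\<lambda>j. n (i + j))"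

lemma cfrac_from_rec:
  assumes "\<And>i. 1 \<le> n i"
  shows "cfrac_from n i = 1 / (real (n i) + cfrac_from n (Suc i))"
proof -
  have "cfrac_from n i = 1 / (real (n (i + 0)) + cfrac (\<lambda>j. n (i + Suc j)))"
    by (rule cfrac_rec) (rule assms)
  then show ?thesis by simp
qed

lemma cfrac_from_pos:
  assumes "\<And>i. 1 \<le> n i"
  shows "0 < cfrac_from n i"
proof -
  have "0 \<le> cfrac_from n (Suc i)" by (rule cfrac_bounds) (rule assms)
  then have "0 < real (n i) + cfrac_from n (Suc i)" using assms[of i] by linarith
  then show ?thesis unfolding cfrac_from_rec[of n i, OF assms] by simp
qed

lemma lam_eq:
  assumes "\<And>i. 1 \<le> n i"
  shows "lam n i = real (n i) + cfrac_from n (Suc i)"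
  unfolding lam_def cfrac_from_rec[of n i, OF assms] by simp

text \<open>Both sides arise from tails far out by the same contraction. Nonnegativity of \<open>\<rho>\<close> makes it
  applicable, and the upper bound keeps the tails within distance 1 of each other.\<close>

lemma cfrac_unique:
  assumes n: "\<And>i. 1 \<le> n i" and \<rho>: "\<And>i. 0 \<le> \<rho> i" "\<And>i. \<rho> i \<le> 1"
    and rec: "\<And>i. \<rho> i = 1 / (real (n i) + \<rho> (Suc i))"
  shows "\<rho> i = cfrac_from n i"
proof -
  have iter: "\<rho> i = cfrac_with_tail k (\<lambda>j. n (i + j)) (\<rho> (i + k))" for k i
  proof (induction k arbitrary: i)
    case (Suc k)
    show ?case unfolding rec[of i] using Suc[of "Suc i"] by simp
  qed simp
  have "\<bar>\<rho> i - cfrac_from n i\<bar> \<le> (1 / 4) ^ j" for j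
  proof -
    have iter': "cfrac_from n i = cfrac_with_tail k (\<lambda>j. n (i + j)) (cfrac_from n (i + k))" for k i
    proof (induction k arbitrary: i)
      case (Suc k)
      show ?case unfolding cfrac_from_rec[of n i, OF n] using Suc[of "Suc i"] by simp
    qed simp
    let ?r = "cfrac_from n (i + 2 * j)"
    have b: "0 \<le> ?r" "?r \<le> 1" by (rule cfrac_bounds, rule n)+
    have "\<bar>\<rho> i - cfrac_from n i\<bar> \<le> (1 / 4) ^ j * \<bar>\<rho> (i + 2 * j) - ?r\<bar>"
      unfolding iter[of i "2 * j"] iter'[of i "2 * j"]
      by (rule cfrac_with_tail_contraction) (rule n \<rho>(1) b(1))+
    also have "\<dots> \<le> (1 / 4) ^ j * 1"
      using b \<rho>(1)[of "i + 2 * j"] \<rho>(2)[of "i + 2 * j"]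
      by (intro mult_left_mono) (linarith, simp)
    finally show ?thesis by simp
  qed
  moreover have "(\<lambda>j. (1 / 4 :: real) ^ j) \<longlonglongrightarrow> 0" by (simp add: LIMSEQ_power_zero)
  ultimately have "\<bar>\<rho> i - cfrac_from n i\<bar> \<le> 0" by (intro LIMSEQ_le_const) auto
  then show ?thesis by simp
qed

section \<open>Growth of the matrix products\<close>

text \<open>The coordinate that \<open>M\<^sub>i\<close> enlarges. The other one is \<open>major (Suc i)\<close>, so statements in terms of
  \<open>major\<close> treat both parities at once.\<close>

definition major :: "nat \<Rightarrow> letter" where
  "major i = (if even i then B else A)"

lemma UNIV_letter: "(UNIV :: letter set) = {A, B}"
  using letter.exhaust by auto

lemma sum_letter: "(\<Sum>a\<in>UNIV. f a) = f (major i) + f (major (Suc i))"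
  for f :: "letter \<Rightarrow> 'a::comm_monoid_add"
  by (auto simp: UNIV_letter major_def add.commute)

lemma major_neq: "major i \<noteq> major (Suc i)"
  by (simp add: major_def)

lemma letter_major_cases: "a = major i \<or> a = major (Suc i)"
  by (cases a) (auto simp: major_def)

lemma major_Suc_Suc [simp]: "major (Suc (Suc i)) = major i"
  by (simp add: major_def)

lemma mult_mat_major:
  "(mult_mat n i *v v) $ major i = real (n i) * v $ major (Suc i) + v $ major i"
  "(mult_mat n i *v v) $ major (Suc i) = v $ major (Suc i)"
  by (auto simp: mult_mat_def matrix_vector_mult_def UNIV_letter major_def)

definition cfrac_vec :: "(nat \<Rightarrow> nat) \<Rightarrow> nat \<Rightarrow> real^letter" where
  "cfrac_vec n i = (\<chi> a. if a = major i then 1 else cfrac_from n i)"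

text \<open>In the coordinates \<open>(major, minor)\<close> this is \<open>\<lambda>\<^sub>i = n\<^sub>i + r\<^sub>i\<^sub>+\<^sub>1\<close> and \<open>\<lambda>\<^sub>i r\<^sub>i = 1\<close>.\<close>

lemma mult_mat_cfrac_vec:
  assumes "\<And>i. 1 \<le> n i"
  shows "mult_mat n i *v cfrac_vec n (Suc i) = lam n i *\<^sub>R cfrac_vec n i"
proof -
  have "lam n i * cfrac_from n i = 1"
    using cfrac_from_pos[of n i, OF assms] by (simp add: lam_def)
  then have "(mult_mat n i *v cfrac_vec n (Suc i)) $ a = (lam n i *\<^sub>R cfrac_vec n i) $ a" for a
    using letter_major_cases[of a i] major_neq[of i] lam_eq[of n i, OF assms]
    by (auto simp: mult_mat_major cfrac_vec_def)
  then show ?thesis by (simp add: vec_eq_iff)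
qed

lemma mat_prod_cfrac_vec:
  assumes "\<And>i. 1 \<le> n i"
  shows "mat_prod n k *v cfrac_vec n (Suc k) = lam_prod n k *\<^sub>R cfrac_vec n 0"
proof (induction k)
  case 0
  show ?case using mult_mat_cfrac_vec[of n, OF assms] by (simp add: lam_prod_def)
next
  case (Suc k)
  have "mat_prod n (Suc k) *v cfrac_vec n (Suc (Suc k))
      = mat_prod n k *v (mult_mat n (Suc k) *v cfrac_vec n (Suc (Suc k)))"
    by (simp add: matrix_vector_mul_assoc)
  also have "\<dots> = lam n (Suc k) *\<^sub>R (mat_prod n k *v cfrac_vec n (Suc k))"
    by (simp add: mult_mat_cfrac_vec[of n, OF assms] matrix_vector_mult_scaleR)
  finally show ?case using Suc by (simp add: lam_prod_def mult.commute)
qed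

lemma lam_prod_pos:
  assumes "\<And>i. 1 \<le> n i"
  shows "0 < lam_prod n k"
  unfolding lam_prod_def lam_def using cfrac_from_pos[of n, OF assms] by (intro prod_pos) auto

lemma eigen_sequencesD:
  assumes "w \<in> eigen_sequences n"
  shows "w i \<noteq> 0" "0 \<le> w i $ a" "mult_mat n i *v w (Suc i) = w i"
proof -
  have "\<forall>i. w i \<noteq> 0 \<and> (\<forall>a. 0 \<le> w i $ a) \<and> w i = mult_mat n i *v w (Suc i)"
    using assms unfolding eigen_sequences_def by blast
  note this[THEN spec, of i]
  then show "w i \<noteq> 0" "0 \<le> w i $ a" "mult_mat n i *v w (Suc i) = w i"
    by (blast, blast, metis)
qed

text \<open>The ratio of the minor to the major coordinate satisfies the recursion of the continued fraction
  and lies in \<open>[0, 1]\<close>, which leaves only one value for it.\<close>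

lemma eigen_sequence_major:
  assumes n: "\<And>i. 1 \<le> n i" and w: "w \<in> eigen_sequences n"
  shows "w i = w i $ major i *\<^sub>R cfrac_vec n i" "0 < w i $ major i"
proof -
  let ?L = "\<lambda>i. w i $ major i" and ?s = "\<lambda>i. w i $ major (Suc i)"
  note nz = eigen_sequencesD(1)[OF w] and ge = eigen_sequencesD(2)[OF w]
    and eq = eigen_sequencesD(3)[OF w]
  have L: "?L i = real (n i) * ?L (Suc i) + ?s (Suc i)" for i
    using mult_mat_major(1)[of n i "w (Suc i)"] unfolding eq by simp
  have s: "?s i = ?L (Suc i)" for i
    using mult_mat_major(2)[of n i "w (Suc i)"] unfolding eq .
  have Lpos: "0 < ?L i" for i
  proof (rule ccontr)
    assume "\<not> 0 < ?L i"
    then have "real (n i) * ?L (Suc i) + ?s (Suc i) \<le> 0" using L[of i] by simp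
    moreover have "0 \<le> real (n i) * ?L (Suc i)" "0 \<le> ?s (Suc i)" using ge by auto
    ultimately have "real (n i) * ?L (Suc i) = 0" "?s (Suc i) = 0" by linarith+
    then have "w (Suc i) $ a = 0" for a
      using letter_major_cases[of a "Suc i"] n[of i] by auto
    then show False using nz[of "Suc i"] by (simp add: vec_eq_iff)
  qed
  define \<rho> where "\<rho> i = ?s i / ?L i" for i
  have rec: "\<rho> i = 1 / (real (n i) + \<rho> (Suc i))" for i
    using Lpos[of "Suc i"] Lpos[of i] unfolding \<rho>_def L[of i] s[of i]
    by (simp add: divide_simps)
  have \<rho>0: "0 \<le> \<rho> i" for i unfolding \<rho>_def using ge by simp
  have \<rho>1: "\<rho> i \<le> 1" for i
  proof -
    have "1 \<le> real (n i) + \<rho> (Suc i)" using \<rho>0[of "Suc i"] n[of i] by linarith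
    then show ?thesis unfolding rec[of i] by simp
  qed
  have "\<rho> i = cfrac_from n i" by (rule cfrac_unique[of n \<rho>]) (fact n \<rho>0 \<rho>1 rec)+
  then have "?s i = ?L i * cfrac_from n i" using Lpos[of i] by (simp add: \<rho>_def divide_simps)
  then have "w i $ a = (?L i *\<^sub>R cfrac_vec n i) $ a" for a
    using letter_major_cases[of a i] major_neq[of i] by (auto simp: cfrac_vec_def)
  then show "w i = ?L i *\<^sub>R cfrac_vec n i" unfolding vec_eq_iff by blast
  show "0 < ?L i" by (rule Lpos)
qed

lemma mat_prod_eigen_sequence:
  assumes "w \<in> eigen_sequences n"
  shows "mat_prod n k *v w (Suc k) = w 0"
  by (induction k) (simp_all add: eigen_sequencesD(3)[OF assms] flip: matrix_vector_mul_assoc)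

lemma eigen_sequence_major_eq:
  assumes "\<And>i. 1 \<le> n i" "w \<in> eigen_sequences n"
  shows "w (Suc k) $ major (Suc k) = w 0 $ major 0 / lam_prod n k"
proof -
  have "w 0 = mat_prod n k *v (w (Suc k) $ major (Suc k) *\<^sub>R cfrac_vec n (Suc k))"
    unfolding eigen_sequence_major(1)[of n w "Suc k", OF assms, symmetric]
    by (rule mat_prod_eigen_sequence[OF assms(2), symmetric])
  also have "\<dots> = (w (Suc k) $ major (Suc k) * lam_prod n k) *\<^sub>R cfrac_vec n 0"
    by (simp only: matrix_vector_mult_scaleR mat_prod_cfrac_vec[of n, OF assms(1)] scaleR_scaleR)
  finally have "w 0 $ major 0
      = ((w (Suc k) $ major (Suc k) * lam_prod n k) *\<^sub>R cfrac_vec n 0) $ major 0"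
    by (rule arg_cong)
  also have "\<dots> = w (Suc k) $ major (Suc k) * lam_prod n k" by (simp add: cfrac_vec_def)
  finally have "w 0 $ major 0 = w (Suc k) $ major (Suc k) * lam_prod n k" .
  then show ?thesis using lam_prod_pos[of n k, OF assms(1)] by (simp add: field_simps)
qed

text \<open>The column sums of \<open>mat_prod\<close>. They count the paths of \<open>k + 1\<close> edges ending in \<open>b\<close>.\<close>

primrec path_count :: "(nat \<Rightarrow> nat) \<Rightarrow> nat \<Rightarrow> letter \<Rightarrow> nat" where
  "path_count n 0 b = (\<Sum>a\<in>UNIV. mult_entry n 0 a b)"
| "path_count n (Suc k) b = (\<Sum>a\<in>UNIV. path_count n k a * mult_entry n (Suc k) a b)"

lemma sum_mat_prod:
  "(\<Sum>a\<in>UNIV. (mat_prod n k *v v) $ a) = (\<Sum>b\<in>UNIV. real (path_count n k b) * v $ b)"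
proof (induction k arbitrary: v)
  case 0
  show ?case
    by (simp add: mult_mat_def matrix_vector_mult_def UNIV_letter algebra_simps)
next
  case (Suc k)
  have "(\<Sum>a\<in>UNIV. (mat_prod n (Suc k) *v v) $ a)
      = (\<Sum>b\<in>UNIV. real (path_count n k b) * (mult_mat n (Suc k) *v v) $ b)"
    by (simp add: Suc flip: matrix_vector_mul_assoc)
  then show ?case
    by (simp add: mult_mat_def matrix_vector_mult_def UNIV_letter algebra_simps)
qed

lemma mult_mat_nonneg:
  assumes "\<And>b. 0 \<le> v $ b"
  shows "0 \<le> (mult_mat n i *v v) $ a"
  using assms by (simp add: mult_mat_def matrix_vector_mult_def sum_nonneg)

lemma mat_prod_nonneg:
  assumes "\<And>b. 0 \<le> v $ b"
  shows "0 \<le> (mat_prod n k *v v) $ a"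
  using assms
  by (induction k arbitrary: v) (simp_all add: mult_mat_nonneg flip: matrix_vector_mul_assoc)

lemma l1norm_mat_prod:
  assumes "\<And>b. 0 \<le> v $ b"
  shows "l1norm (mat_prod n k *v v) = (\<Sum>b\<in>UNIV. real (path_count n k b) * v $ b)"
  using sum_mat_prod[of n k v] mat_prod_nonneg[OF assms] by (simp add: l1norm_def)

text \<open>Already in \<open>M\<^sub>k\<close> the column of \<open>major k\<close> is a unit vector, below the other column entrywise.\<close>

lemma path_count_minor_le_major:
  assumes "\<And>i. 1 \<le> n i"
  shows "path_count n k (major k) \<le> path_count n k (major (Suc k))"
proof -
  have "mult_entry n k a (major k) \<le> mult_entry n k a (major (Suc k))" for a
    using assms[of k] by (cases a) (auto simp: major_def)
  then show ?thesis by (cases k) (auto intro!: sum_mono simp del: mult_entry.simps)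
qed

text \<open>The vector \<open>cfrac_vec n (Suc k)\<close> lies between the unit vector of the major letter and the vector of
  ones, whatever the sequence \<open>n\<close>. This is what makes two different sequences comparable.\<close>

lemma l1norm_mat_prod_bounds:
  assumes nh: "\<And>i. 1 \<le> nh i" and n: "\<And>i. 1 \<le> n i"
  shows "real (path_count nh k (major (Suc k))) \<le> l1norm (mat_prod nh k *v cfrac_vec n (Suc k))"
    "l1norm (mat_prod nh k *v cfrac_vec n (Suc k)) \<le> 2 * real (path_count nh k (major (Suc k)))"
proof -
  let ?c = "path_count nh k" and ?r = "cfrac_from n (Suc k)"
  have r: "0 \<le> ?r" "?r \<le> 1" by (rule cfrac_bounds, rule n)+
  have "0 \<le> cfrac_vec n (Suc k) $ b" for b using r by (simp add: cfrac_vec_def)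
  then have eq: "l1norm (mat_prod nh k *v cfrac_vec n (Suc k))
      = real (?c (major (Suc k))) + real (?c (major k)) * ?r"
    using major_neq[of k] by (simp add: l1norm_mat_prod sum_letter[of _ "Suc k"] cfrac_vec_def)
  have "real (?c (major k)) * ?r \<le> real (?c (major (Suc k))) * 1"
    using r path_count_minor_le_major[of nh, OF nh] by (intro mult_mono) auto
  then show "real (?c (major (Suc k))) \<le> l1norm (mat_prod nh k *v cfrac_vec n (Suc k))"
    "l1norm (mat_prod nh k *v cfrac_vec n (Suc k)) \<le> 2 * real (?c (major (Suc k)))"
    using eq r by auto
qed

lemma l1norm_scaleR: "l1norm (c *\<^sub>R v) = \<bar>c\<bar> * l1norm v"
  by (simp add: l1norm_def abs_mult sum_distrib_left)

text \<open>Both \<open>cfrac_vec n\<close> and \<open>cfrac_vec nh\<close> give norms within a factor two of the same path count, and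
  for \<open>nh\<close> the norm is known exactly to be \<open>lam_prod nh k\<close> times a constant.\<close>

lemma l1norm_eigen_sequence_comparable:
  assumes nh: "\<And>i. 1 \<le> nh i" and n: "\<And>i. 1 \<le> n i" and w: "w \<in> eigen_sequences n"
  obtains C where "0 < C"
    "\<And>k. C * (lam_prod nh k / lam_prod n k) \<le> l1norm (mat_prod nh k *v w (Suc k))"
    "\<And>k. l1norm (mat_prod nh k *v w (Suc k)) \<le> 4 * C * (lam_prod nh k / lam_prod n k)"
proof
  define K where "K = l1norm (cfrac_vec nh 0)"
  define L where "L = w 0 $ major 0"
  have L: "0 < L" unfolding L_def using eigen_sequence_major(2)[of n w, OF n w] by blast
  have "0 < K"
    using cfrac_from_pos[of nh 0, OF nh] major_neq[of 0]
    by (simp add: K_def l1norm_def sum_letter[of _ 0] cfrac_vec_def)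
  then show "0 < L * K / 2" using L by simp
  fix k
  let ?c = "real (path_count nh k (major (Suc k)))"
  have hat: "l1norm (mat_prod nh k *v cfrac_vec nh (Suc k)) = lam_prod nh k * K"
    using lam_prod_pos[of nh k, OF nh] by (simp add: mat_prod_cfrac_vec[of nh, OF nh] l1norm_scaleR K_def)
  have pos: "0 < L / lam_prod n k" using L lam_prod_pos[of n k, OF n] by simp
  have "w (Suc k) = (L / lam_prod n k) *\<^sub>R cfrac_vec n (Suc k)"
    using eigen_sequence_major(1)[of n w "Suc k", OF n w]
    unfolding eigen_sequence_major_eq[of n w k, OF n w] L_def[symmetric] .
  then have eq: "l1norm (mat_prod nh k *v w (Suc k))
      = L / lam_prod n k * l1norm (mat_prod nh k *v cfrac_vec n (Suc k))"
    using pos by (simp only: matrix_vector_mult_scaleR l1norm_scaleR abs_of_pos)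
  have lo: "lam_prod nh k * K / 2 \<le> l1norm (mat_prod nh k *v cfrac_vec n (Suc k))"
    using l1norm_mat_prod_bounds(1)[of nh n k, OF nh n] l1norm_mat_prod_bounds(2)[of nh nh k, OF nh nh] hat
    by simp
  have hi: "l1norm (mat_prod nh k *v cfrac_vec n (Suc k)) \<le> 2 * (lam_prod nh k * K)"
    using l1norm_mat_prod_bounds(2)[of nh n k, OF nh n] l1norm_mat_prod_bounds(1)[of nh nh k, OF nh nh] hat
    by simp
  show "L * K / 2 * (lam_prod nh k / lam_prod n k) \<le> l1norm (mat_prod nh k *v w (Suc k))"
    unfolding eq using mult_left_mono[OF lo less_imp_le[OF pos]] by (simp add: mult_ac)
  show "l1norm (mat_prod nh k *v w (Suc k)) \<le> 4 * (L * K / 2) * (lam_prod nh k / lam_prod n k)"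
    unfolding eq using mult_left_mono[OF hi less_imp_le[OF pos]] by (simp add: mult_ac)
qed

section \<open>Limits inferior\<close>

lemma liminf_finite_le:
  fixes f g :: "nat \<Rightarrow> real"
  assumes "\<And>k. f k \<le> c * g k" "0 < c" "liminf (\<lambda>k. ereal (g k)) < \<infinity>"
  shows "liminf (\<lambda>k. ereal (f k)) < \<infinity>"
proof -
  have "liminf (\<lambda>k. ereal (f k)) \<le> liminf (\<lambda>k. ereal c * ereal (g k))"
    using assms(1) by (intro Liminf_mono) simp
  also have "\<dots> = ereal c * liminf (\<lambda>k. ereal (g k))"
    using assms(2) by (intro Liminf_ereal_mult_left) auto
  also have "\<dots> < \<infinity>" using assms(2,3) by (cases "liminf (\<lambda>k. ereal (g k))") auto
  finally show ?thesis .
qed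

lemma liminf_incseq_finite_iff:
  fixes f :: "nat \<Rightarrow> real"
  assumes "incseq f"
  shows "liminf (\<lambda>k. ereal (f k)) < \<infinity> \<longleftrightarrow> (\<exists>C. \<forall>k. f k \<le> C)"
proof
  assume fin: "liminf (\<lambda>k. ereal (f k)) < \<infinity>"
  have le: "ereal (f k) \<le> liminf (\<lambda>k. ereal (f k))" for k
    using assms by (intro Liminf_bounded eventually_sequentiallyI[of k]) (simp add: incseqD)
  with fin show "\<exists>C. \<forall>k. f k \<le> C"
    by (cases "liminf (\<lambda>k. ereal (f k))") auto
next
  assume "\<exists>C. \<forall>k. f k \<le> C"
  then obtain C where "\<And>k. f k \<le> C" by blast
  then have "liminf (\<lambda>k. ereal (f k)) \<le> ereal C"
    by (intro Liminf_le always_eventually) auto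
  then show "liminf (\<lambda>k. ereal (f k)) < \<infinity>" by (rule order_le_less_trans) simp
qed

section \<open>Inner regularity\<close>

lemma space_borel_of: "space (borel_of X) = topspace X"
  by (simp add: borel_of_def space_measure_of_conv)

lemma sets_borel_of: "sets (borel_of X) = sigma_sets (topspace X) {U. openin X U}"
  unfolding borel_of_def by (rule sets_measure_of) (auto dest: openin_subset)

lemma openin_in_borel_of: "openin X U \<Longrightarrow> U \<in> sets (borel_of X)"
  by (auto simp: sets_borel_of)

lemma closedin_in_borel_of:
  assumes "closedin X C"
  shows "C \<in> sets (borel_of X)"
proof -
  have "topspace X - (topspace X - C) \<in> sets (borel_of X)"
    unfolding sets_borel_of using assms
    by (intro sigma_sets.Compl sigma_sets.Basic) (auto simp: closedin_def)
  moreover have "topspace X - (topspace X - C) = C" using closedin_subset[OF assms] by blast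
  ultimately show ?thesis by simp
qed

lemma continuous_map_borel_measurable:
  assumes "sets \<mu> = sets (borel_of X)" "continuous_map X euclidean f"
  shows "f \<in> borel_measurable \<mu>"
proof (rule borel_measurableI)
  fix U :: "'b set" assume "open U"
  then have "openin X {x \<in> topspace X. f x \<in> U}"
    using openin_continuous_map_preimage[OF assms(2), of U] by simp
  moreover have "space \<mu> = topspace X"
    using sets_eq_imp_space_eq[OF assms(1)] by (simp add: space_borel_of)
  then have "f -` U \<inter> space \<mu> = {x \<in> topspace X. f x \<in> U}" by auto
  ultimately show "f -` U \<inter> space \<mu> \<in> sets \<mu>" using openin_in_borel_of assms(1) by metis
qed

text \<open>A continuous injection of a compact space into a Hausdorff space is an embedding, so open sets, and
  with them Borel sets, are preimages.\<close>

lemma borel_of_compact_injective_preimage: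
  fixes \<phi> :: "'a \<Rightarrow> 'b::t2_space"
  assumes X: "compact_space X" and \<phi>: "continuous_map X euclidean \<phi>" "inj_on \<phi> (topspace X)"
    and S: "S \<in> sets (borel_of X)"
  shows "\<exists>B\<in>sets borel. S = \<phi> -` B \<inter> topspace X"
  using S unfolding sets_borel_of
proof (induction rule: sigma_sets.induct)
  case (Basic U)
  then have U: "openin X U" by simp
  have "compactin X (topspace X - U)" using X U by (intro closedin_compact_space) auto
  then have "compact (\<phi> ` (topspace X - U))"
    using image_compactin[OF _ \<phi>(1)] by (simp add: compactin_euclidean_iff)
  then have "- \<phi> ` (topspace X - U) \<in> sets borel" by (simp add: compact_imp_closed borel_open open_Compl)
  moreover have "U = \<phi> -` (- \<phi> ` (topspace X - U)) \<inter> topspace X"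
    using openin_subset[OF U] inj_onD[OF \<phi>(2)] by blast
  ultimately show ?case by blast
next
  case Empty
  then show ?case by (intro bexI[of _ "{}"]) auto
next
  case (Compl S)
  then obtain B where "B \<in> sets borel" "S = \<phi> -` B \<inter> topspace X" by blast
  then show ?case by (intro bexI[of _ "- B"]) (auto simp: borel_comp)
next
  case (Union S)
  then obtain B where "\<And>i. B i \<in> sets borel" "\<And>i. S i = \<phi> -` B i \<inter> topspace X" by metis
  then show ?case by (intro bexI[of _ "\<Union>i. B i"]) auto
qed

text \<open>On each piece \<open>T k\<close> the image measure under \<open>\<phi>\<close> is a finite Borel measure on a Polish space. The
  compact sets approximating there have compact preimages. These may leave \<open>T k\<close>, which does no harm
  as they stay inside the given set.\<close>

lemma inner_regular_in_sigma_finite: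
  fixes \<phi> :: "'a \<Rightarrow> 'b::polish_space"
  assumes X: "compact_space X" and \<phi>: "continuous_map X euclidean \<phi>" "inj_on \<phi> (topspace X)"
    and \<mu>: "sets \<mu> = sets (borel_of X)"
    and T: "\<And>k :: nat. T k \<in> sets \<mu>" "incseq T" "\<And>k. emeasure \<mu> (T k) < \<infinity>"
    and null: "emeasure \<mu> (topspace X - (\<Union>k. T k)) = 0"
  shows "inner_regular_in X \<mu>"
  unfolding inner_regular_in_def
proof (intro ballI antisym)
  fix S assume S: "S \<in> sets \<mu>"
  let ?I = "SUP K\<in>{K. compactin X K \<and> K \<subseteq> S}. emeasure \<mu> K"
  have space: "space \<mu> = topspace X"
    using sets_eq_imp_space_eq[OF \<mu>] by (simp add: space_borel_of)
  have meas: "\<phi> \<in> borel_measurable \<mu>" by (rule continuous_map_borel_measurable[OF \<mu> \<phi>(1)])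
  show "?I \<le> emeasure \<mu> S" using S by (intro SUP_least emeasure_mono) auto
  obtain B where B: "B \<in> sets borel" "S = \<phi> -` B \<inter> topspace X"
    using borel_of_compact_injective_preimage[OF X \<phi>] S \<mu> by blast
  \<comment> \<open>The preimage of a compact set is closed, and compact because \<open>X\<close> is.\<close>
  have piece: "emeasure \<mu> (S \<inter> T k) \<le> ?I" for k
  proof -
    define N where "N = distr (restrict_space \<mu> (T k)) borel \<phi>"
    have Tk: "T k \<inter> space \<mu> \<in> sets \<mu>" "T k \<subseteq> topspace X"
      using T(1)[of k] sets.sets_into_space[OF T(1), of k] space by (simp_all add: Int_absorb2)
    have N: "emeasure N D = emeasure \<mu> (\<phi> -` D \<inter> T k)" if "D \<in> sets borel" for D
    proof -
      have "emeasure N D = emeasure (restrict_space \<mu> (T k)) (\<phi> -` D \<inter> space (restrict_space \<mu> (T k)))"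
        unfolding N_def using that meas by (intro emeasure_distr measurable_restrict_space1)
      also have "\<dots> = emeasure \<mu> (\<phi> -` D \<inter> T k)"
        using Tk by (subst emeasure_restrict_space) (auto simp: space_restrict_space space Int_absorb2)
      finally show ?thesis .
    qed
    have "emeasure N (space N) \<noteq> \<infinity>"
      using T(3)[of k] N[of UNIV] by (simp add: N_def)
    then have "emeasure N B = (SUP K\<in>{K. K \<subseteq> B \<and> compact K}. emeasure N K)"
      using B by (intro inner_regular) (auto simp: N_def)
    also have "\<dots> \<le> ?I"
    proof (rule SUP_least)
      fix K assume "K \<in> {K. K \<subseteq> B \<and> compact K}"
      then have K: "K \<subseteq> B" "closed K" by (auto simp: compact_imp_closed)
      let ?K = "{x \<in> topspace X. \<phi> x \<in> K}"
      have cl: "closedin X ?K" using closedin_continuous_map_preimage[OF \<phi>(1), of K] K by simp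
      have "emeasure N K = emeasure \<mu> (\<phi> -` K \<inter> T k)" using K N by (simp add: borel_closed)
      also have "\<dots> \<le> emeasure \<mu> ?K"
        using closedin_in_borel_of[OF cl] \<mu> Tk(2) by (intro emeasure_mono) auto
      also have "\<dots> \<le> ?I"
        using closedin_compact_space[OF X cl] K(1) B(2) by (intro SUP_upper) auto
      finally show "emeasure N K \<le> ?I" .
    qed
    also have "emeasure N B = emeasure \<mu> (S \<inter> T k)"
      using N[OF B(1)] B(2) Tk(2) by (metis Int_absorb1 Int_assoc inf_commute)
    finally show ?thesis .
  qed
  have "emeasure \<mu> S \<le> emeasure \<mu> ((\<Union>k. S \<inter> T k) \<union> (topspace X - (\<Union>k. T k)))"
    using S T(1) \<mu> space sets.sets_into_space[OF S] sets.top[of \<mu>]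
    by (intro emeasure_mono) (auto intro!: sets.Un sets.Diff sets.countable_UN)
  also have "\<dots> \<le> emeasure \<mu> (\<Union>k. S \<inter> T k) + emeasure \<mu> (topspace X - (\<Union>k. T k))"
    using S T(1) space sets.top[of \<mu>]
    by (intro emeasure_subadditive) (auto intro!: sets.Diff sets.countable_UN)
  also have "\<dots> = (SUP k. emeasure \<mu> (S \<inter> T k))"
    using S T(1,2) null by (subst SUP_emeasure_incseq) (auto simp: incseq_def)
  also have "\<dots> \<le> ?I" using piece by (rule SUP_least)
  finally show "emeasure \<mu> S \<le> ?I" .
qed

text \<open>The image of a compact set approximating the preimage of \<open>S\<close> is a compact subset of \<open>S\<close>. The
  Hausdorff property makes this image Borel.\<close>

lemma inner_regular_in_distr:
  fixes \<pi> :: "'a \<Rightarrow> 'b::topological_space"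
  assumes reg: "inner_regular_in X \<mu>" and \<mu>: "sets \<mu> = sets (borel_of X)"
    and \<pi>: "continuous_map X euclidean \<pi>" and haus: "Hausdorff_space (euclidean :: 'b topology)"
  shows "inner_regular_in euclidean (distr \<mu> borel \<pi>)"
  unfolding inner_regular_in_def
proof (intro ballI antisym)
  fix S assume "S \<in> sets (distr \<mu> borel \<pi>)"
  then have S: "S \<in> sets borel" by simp
  let ?D = "distr \<mu> borel \<pi>"
  have space: "space \<mu> = topspace X"
    using sets_eq_imp_space_eq[OF \<mu>] by (simp add: space_borel_of)
  have meas: "\<pi> \<in> borel_measurable \<mu>" by (rule continuous_map_borel_measurable[OF \<mu> \<pi>])
  show "(SUP K\<in>{K. compactin euclidean K \<and> K \<subseteq> S}. emeasure ?D K) \<le> emeasure ?D S"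
    using S by (intro SUP_least emeasure_mono) auto
  have "emeasure ?D S = emeasure \<mu> (\<pi> -` S \<inter> space \<mu>)"
    using S meas by (simp add: emeasure_distr)
  also have "\<dots> = (SUP K\<in>{K. compactin X K \<and> K \<subseteq> \<pi> -` S \<inter> space \<mu>}. emeasure \<mu> K)"
    using reg measurable_sets[OF meas S] unfolding inner_regular_in_def by blast
  also have "\<dots> \<le> (SUP K\<in>{K. compactin euclidean K \<and> K \<subseteq> S}. emeasure ?D K)"
  proof (rule SUP_mono)
    fix K assume "K \<in> {K. compactin X K \<and> K \<subseteq> \<pi> -` S \<inter> space \<mu>}"
    then have K: "compactin X K" "K \<subseteq> \<pi> -` S \<inter> space \<mu>" by auto
    have comp: "compactin euclidean (\<pi> ` K)" by (rule image_compactin[OF K(1) \<pi>])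
    then have "closed (\<pi> ` K)" using compactin_imp_closedin[OF haus] by simp
    then have borel: "\<pi> ` K \<in> sets borel" by (rule borel_closed)
    have "emeasure \<mu> K \<le> emeasure \<mu> (\<pi> -` (\<pi> ` K) \<inter> space \<mu>)"
      using K(2) measurable_sets[OF meas borel] by (intro emeasure_mono) auto
    also have "\<dots> = emeasure ?D (\<pi> ` K)" using borel meas by (simp add: emeasure_distr)
    finally show "\<exists>L\<in>{K. compactin euclidean K \<and> K \<subseteq> S}. emeasure \<mu> K \<le> emeasure ?D L"
      using comp K(2) by auto
  qed
  finally show "emeasure ?D S \<le> (SUP K\<in>{K. compactin euclidean K \<and> K \<subseteq> S}. emeasure ?D K)" .
qed

text \<open>The preimage of the image is the union of the integer translates.\<close>

lemma open_abs_circle_image: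
  assumes "open W"
  shows "open (abs_circle ` W)"
proof -
  have "abs_circle -` (abs_circle ` W) = (\<Union>z\<in>\<int>. (+) z ` W)"
  proof (intro set_eqI iffI)
    fix x assume "x \<in> abs_circle -` (abs_circle ` W)"
    then obtain y where "y \<in> W" "abs_circle x = abs_circle y" by auto
    then have "x - y \<in> \<int>" "x = (x - y) + y" by (auto simp: circle.abs_eq_iff)
    with \<open>y \<in> W\<close> show "x \<in> (\<Union>z\<in>\<int>. (+) z ` W)" by blast
  next
    fix x assume "x \<in> (\<Union>z\<in>\<int>. (+) z ` W)"
    then obtain z y where "z \<in> \<int>" "y \<in> W" "x = z + y" by auto
    then have "abs_circle x = abs_circle y" by (simp add: circle.abs_eq_iff)
    with \<open>y \<in> W\<close> show "x \<in> abs_circle -` (abs_circle ` W)" by auto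
  qed
  also have "open \<dots>" using assms by (intro open_UN ballI open_translation)
  finally show ?thesis by (simp add: open_circle_def)
qed

text \<open>The difference of two representatives has a positive distance from the closed set of integers.\<close>

lemma Hausdorff_space_circle: "Hausdorff_space (euclidean :: circle topology)"
  unfolding Hausdorff_space_def
proof (intro allI impI)
  fix x y :: circle assume xy: "x \<in> topspace euclidean \<and> y \<in> topspace euclidean \<and> x \<noteq> y"
  obtain a b where ab: "x = abs_circle a" "y = abs_circle b"
    using circle.abs_induct[of "\<lambda>z. \<exists>c. z = abs_circle c"] by blast
  then have "a - b \<in> - \<int>" using xy by (simp add: circle.abs_eq_iff)
  moreover have "open (- \<int> :: real set)" by (simp add: closed_Ints open_Compl)
  ultimately obtain e where e: "0 < e" "ball (a - b) e \<subseteq> - \<int>"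
    using open_contains_ball by blast
  let ?U = "abs_circle ` ball a (e / 2)" and ?V = "abs_circle ` ball b (e / 2)"
  have "disjnt ?U ?V"
  proof (rule ccontr)
    assume "\<not> disjnt ?U ?V"
    then obtain s t where st: "s \<in> ball a (e / 2)" "t \<in> ball b (e / 2)" "abs_circle s = abs_circle t"
      unfolding disjnt_def by auto
    then have "s - t \<in> ball (a - b) e" by (auto simp: dist_real_def abs_if split: if_splits)
    moreover have "s - t \<in> \<int>" using st(3) by (simp add: circle.abs_eq_iff)
    ultimately show False using e(2) by blast
  qed
  moreover have "open ?U" "open ?V" by (simp_all add: open_abs_circle_image)
  moreover have "x \<in> ?U" "y \<in> ?V" using ab e(1) by auto
  ultimately show "\<exists>U V. openin euclidean U \<and> openin euclidean V \<and> x \<in> U \<and> y \<in> V \<and> disjnt U V"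
    by (auto simp flip: open_openin)
qed

section \<open>Path spaces\<close>

lemma topspace_path_top: "topspace (path_top E) = paths E"
  by (auto simp: path_top_def paths_def PiE_iff)

lemma continuous_map_path_coord:
  "continuous_map (path_top E) (discrete_topology (E i)) (\<lambda>x. x i)"
  unfolding path_top_def
  by (intro continuous_map_from_subtopology continuous_map_product_projection) simp

lemma closedin_path_coord: "closedin (path_top E) {x \<in> paths E. x i \<in> S}"
proof -
  have "closedin (path_top E) {x \<in> topspace (path_top E). x i \<in> S \<inter> E i}"
    by (rule closedin_continuous_map_preimage[OF continuous_map_path_coord]) auto
  also have "{x \<in> topspace (path_top E). x i \<in> S \<inter> E i} = {x \<in> paths E. x i \<in> S}"
    by (auto simp: topspace_path_top paths_def)
  finally show ?thesis .
qed

lemma closedin_path_coords: "closedin (path_top E) {x \<in> paths E. \<forall>i\<in>I. x i \<in> S i}"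
proof (cases "I = {}")
  case True
  then show ?thesis using closedin_topspace[of "path_top E"] by (simp add: topspace_path_top)
next
  case False
  have "closedin (path_top E) (\<Inter>i\<in>I. {x \<in> paths E. x i \<in> S i})"
    using False by (intro closedin_Inter) (auto simp: closedin_path_coord)
  also have "(\<Inter>i\<in>I. {x \<in> paths E. x i \<in> S i}) = {x \<in> paths E. \<forall>i\<in>I. x i \<in> S i}"
    using False by auto
  finally show ?thesis .
qed

lemma closedin_cyl: "closedin (path_top E) (cyl E p)"
  using closedin_path_coords[of E "{..<length p}" "\<lambda>i. {p ! i}"] by (simp add: cyl_def Ball_def)

text \<open>A basic open set of the product constrains only finitely many coordinates. The length \<open>m + 1\<close> is
  positive because finite paths are nonempty.\<close>

lemma open_contains_cyl:
  assumes U: "openin (path_top E) U" and x: "x \<in> U"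
  obtains m where "cyl E (map x [0..<Suc m]) \<subseteq> U"
proof -
  let ?P = "product_topology (\<lambda>i. discrete_topology (E i)) UNIV"
  obtain V where V: "openin ?P V" "U = V \<inter> paths E"
    using U unfolding path_top_def openin_subtopology by blast
  obtain W where W: "finite {i. W i \<noteq> E i}" "x \<in> Pi\<^sub>E UNIV W" "Pi\<^sub>E UNIV W \<subseteq> V"
    using V x unfolding openin_product_topology_alt by force
  obtain m where m: "\<And>i. W i \<noteq> E i \<Longrightarrow> i \<le> m"
    using W(1) unfolding finite_nat_set_iff_bounded_le by blast
  have "y \<in> U" if "y \<in> cyl E (map x [0..<Suc m])" for y
  proof -
    have y: "y \<in> paths E" "\<And>i. i \<le> m \<Longrightarrow> y i = x i"
      using that unfolding cyl_def by (auto simp: less_Suc_eq_le simp del: upt_Suc)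
    have "y i \<in> W i" for i
      using y(2)[of i] m[of i] W(2) y(1) by (cases "i \<le> m") (auto simp: paths_def)
    then show ?thesis using W(3) V(2) y(1) by auto
  qed
  then show ?thesis using that by blast
qed

text \<open>The compatibility of consecutive edges is a closed condition in a product of finite discrete spaces.\<close>

lemma compact_space_path_top:
  assumes "\<And>i. finite (E i)"
  shows "compact_space (path_top E)"
proof -
  let ?P = "product_topology (\<lambda>i. discrete_topology (E i)) UNIV"
  have coord: "closedin ?P {x \<in> topspace ?P. x i \<in> S}" for i S
  proof -
    have "closedin ?P {x \<in> topspace ?P. x i \<in> S \<inter> E i}"
      by (rule closedin_continuous_map_preimage[OF continuous_map_product_projection]) auto
    also have "{x \<in> topspace ?P. x i \<in> S \<inter> E i} = {x \<in> topspace ?P. x i \<in> S}"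
      by (auto simp: PiE_iff)
    finally show ?thesis .
  qed
  let ?C = "\<lambda>i. \<Union>a. {x \<in> topspace ?P. x i \<in> {e. tgt e = a}} \<inter> {x \<in> topspace ?P. x (Suc i) \<in> {e. src e = a}}"
  have "closedin ?P (\<Inter>i. ?C i)"
  proof (intro closedin_INT)
    fix i
    let ?D = "\<lambda>a. {x \<in> topspace ?P. x i \<in> {e. tgt e = a}}
      \<inter> {x \<in> topspace ?P. x (Suc i) \<in> {e. src e = a}}"
    have "closedin ?P (?D a)" for a by (intro closedin_Int coord)
    then have "closedin ?P (\<Union>(range ?D))" by (intro closedin_Union finite_imageI finite) blast
    then show "closedin ?P (?C i)" .
  qed auto
  also have "(\<Inter>i. ?C i) = paths E"
  proof (intro set_eqI iffI)
    fix x assume "x \<in> (\<Inter>i. ?C i)"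
    then have "x i \<in> E i \<and> tgt (x i) = src (x (Suc i))" for i
      by (auto dest: spec[of _ i])
    then show "x \<in> paths E" by (simp add: paths_def)
  next
    fix x assume "x \<in> paths E"
    then have "x i \<in> E i" "tgt (x i) = src (x (Suc i))" for i by (simp_all add: paths_def)
    then show "x \<in> (\<Inter>i. ?C i)" by (simp add: PiE_iff)
  qed
  finally have "closedin ?P (paths E)" .
  moreover have "compact_space ?P"
    using assms by (simp add: compact_space_product_topology compact_space_discrete_topology)
  ultimately show ?thesis
    unfolding path_top_def by (intro compact_space_subtopology closedin_compact_space)
qed

text \<open>Any injective numbering of the edges, applied coordinatewise, will do.\<close>

lemma path_top_embedding:
  obtains \<phi> :: "path \<Rightarrow> nat \<Rightarrow> real"
  where "continuous_map (path_top E) euclidean \<phi>" "inj_on \<phi> (topspace (path_top E))"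
proof -
  have "e \<in> (\<lambda>(a, b, k). Edge a b k) ` (UNIV \<times> UNIV \<times> UNIV)" for e
    by (cases e) (auto simp: image_iff)
  then have "(UNIV :: edge set) \<subseteq> (\<lambda>(a, b, k). Edge a b k) ` (UNIV \<times> UNIV \<times> UNIV)"
    by blast
  moreover have "countable ((UNIV :: letter set) \<times> (UNIV :: letter set) \<times> (UNIV :: nat set))"
    by (intro countable_SIGMA countable_finite[OF finite] countableI_type)
  ultimately have "countable (UNIV :: edge set)" by (rule countable_subset[OF _ countable_image])
  then obtain c :: "edge \<Rightarrow> nat" where c: "inj c" unfolding countable_def by blast
  show ?thesis
  proof
    let ?\<phi> = "\<lambda>x i. real (c (x i))"
    have "continuous_map (path_top E) euclidean (\<lambda>x. real (c (x i)))" for i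
      using continuous_map_compose[OF continuous_map_path_coord[of E i],
          of euclidean "\<lambda>e. real (c e)"]
      by (simp add: continuous_map_from_discrete_topology o_def)
    then show "continuous_map (path_top E) euclidean ?\<phi>"
      unfolding euclidean_product_topology[symmetric] continuous_map_componentwise_UNIV by blast
    show "inj_on ?\<phi> (topspace (path_top E))"
      using c by (intro inj_onI) (simp add: fun_eq_iff inj_def)
  qed
qed

lemma finite_path_append:
  assumes "finite_path E p" "e \<in> E (length p)" "tgt (last p) = src e"
  shows "finite_path E (p @ [e])"
proof -
  have p: "p \<noteq> []" "\<And>i. i < length p \<Longrightarrow> p ! i \<in> E i"
    "\<And>i. Suc i < length p \<Longrightarrow> tgt (p ! i) = src (p ! Suc i)"
    using assms(1) unfolding finite_path_def by blast+
  have "(p @ [e]) ! i \<in> E i" if "i < Suc (length p)" for i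
    using that p(2)[of i] assms(2) by (cases "i = length p") (simp_all add: nth_append)
  moreover have "tgt ((p @ [e]) ! i) = src ((p @ [e]) ! Suc i)" if "i < length p" for i
  proof (cases "Suc i = length p")
    case True
    then have "p ! i = last p" using p(1) last_conv_nth[OF p(1)] by (simp flip: True)
    then show ?thesis using assms(3) True that by (simp add: nth_append)
  next
    case False
    then show ?thesis using p(3)[of i] that by (simp add: nth_append)
  qed
  ultimately show ?thesis by (simp add: finite_path_def)
qed

lemma finite_path_butlast:
  assumes "finite_path E (p @ [e])" "p \<noteq> []"
  shows "finite_path E p" "e \<in> E (length p)" "tgt (last p) = src e"
proof -
  have edge: "(p @ [e]) ! i \<in> E i" if "i < Suc (length p)" for i
    using assms(1) that unfolding finite_path_def by simp
  have step: "tgt ((p @ [e]) ! i) = src ((p @ [e]) ! Suc i)" if "i < length p" for i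
    using assms(1) that unfolding finite_path_def by simp
  have "p ! i \<in> E i" if "i < length p" for i using edge[of i] that by (simp add: nth_append)
  moreover have "tgt (p ! i) = src (p ! Suc i)" if "Suc i < length p" for i
    using step[of i] that by (simp add: nth_append)
  ultimately show "finite_path E p" using assms(2) unfolding finite_path_def by blast
  show "e \<in> E (length p)" using edge[of "length p"] by simp
  show "tgt (last p) = src e"
    using step[of "length p - 1"] assms(2) by (simp add: nth_append last_conv_nth)
qed

lemma finite_path_initial:
  assumes "x \<in> paths E"
  shows "finite_path E (map x [0..<Suc m])"
  using assms unfolding finite_path_def paths_def by (auto simp del: upt_Suc)

lemma tgt_last_cyl:
  assumes "x \<in> cyl E p" "finite_path E p"
  shows "tgt (last p) = src (x (length p))"
proof -
  obtain m where m: "length p = Suc m"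
    using assms(2) by (cases p) (auto simp: finite_path_def)
  then have "last p = x m"
    using assms unfolding cyl_def finite_path_def by (auto simp: last_conv_nth)
  moreover have "tgt (x m) = src (x (Suc m))" using assms(1) unfolding cyl_def paths_def by blast
  ultimately show ?thesis using m by simp
qed

lemma replace_init_cyl:
  assumes x: "x \<in> cyl E p" and p: "finite_path E p" and q: "finite_path E q"
    and len: "length p = length q" and tgt: "tgt (last p) = tgt (last q)"
  shows "replace_init q x \<in> cyl E q"
proof -
  have "tgt (replace_init q x i) = src (replace_init q x (Suc i))" for i
  proof -
    consider "Suc i < length q" | "Suc i = length q" | "length q \<le> i" by linarith
    then show ?thesis
    proof cases
      case 1
      then show ?thesis using q unfolding finite_path_def replace_init_def by simp
    next
      case 2
      have "q \<noteq> []" using q unfolding finite_path_def by blast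
      then have "last q = q ! i" using last_conv_nth[of q] by (simp flip: 2)
      then show ?thesis
        using 2 tgt_last_cyl[OF x p] tgt len by (simp add: replace_init_def)
    next
      case 3
      then show ?thesis using x unfolding replace_init_def cyl_def paths_def by simp
    qed
  qed
  moreover have "replace_init q x i \<in> E i" for i
    using x q unfolding replace_init_def cyl_def paths_def finite_path_def by simp
  ultimately show ?thesis by (simp add: cyl_def paths_def replace_init_def)
qed

text \<open>With \<open>F = E\<close> this is the whole cylinder. With a smaller edge system \<open>F\<close> it is the part of the cylinder
  whose tower measure is determined by the central measure.\<close>

definition cyl_tail :: "(nat \<Rightarrow> edge set) \<Rightarrow> (nat \<Rightarrow> edge set) \<Rightarrow> edge list \<Rightarrow> path set" where
  "cyl_tail E F p = {x \<in> cyl E p. \<forall>i\<ge>length p. x i \<in> F i}"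

lemma cyl_tail_self: "cyl_tail E E p = cyl E p"
  by (auto simp: cyl_tail_def cyl_def paths_def)

lemma closedin_cyl_tail: "closedin (path_top E) (cyl_tail E F p)"
proof -
  have "cyl_tail E F p = cyl E p \<inter> {x \<in> paths E. \<forall>i\<in>{length p..}. x i \<in> F i}"
    by (auto simp: cyl_tail_def cyl_def)
  then show ?thesis by (simp only:) (intro closedin_Int closedin_cyl closedin_path_coords)
qed

lemma replace_init_cyl_tail:
  assumes "finite_path E p" "finite_path E q" "length p = length q" "tgt (last p) = tgt (last q)"
  shows "replace_init q ` cyl_tail E F p = cyl_tail E F q"
proof
  show "replace_init q ` cyl_tail E F p \<subseteq> cyl_tail E F q"
    using replace_init_cyl[OF _ assms] assms(3) by (auto simp: cyl_tail_def replace_init_def)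
next
  show "cyl_tail E F q \<subseteq> replace_init q ` cyl_tail E F p"
  proof
    fix y assume y: "y \<in> cyl_tail E F q"
    then have "replace_init p y \<in> cyl_tail E F p"
      using replace_init_cyl[OF _ assms(2,1) assms(3,4)[symmetric]] assms(3)
      by (auto simp: cyl_tail_def replace_init_def)
    moreover have "y = replace_init q (replace_init p y)"
      using y assms(3) by (auto simp: cyl_tail_def cyl_def replace_init_def)
    ultimately show "y \<in> replace_init q ` cyl_tail E F p" by blast
  qed
qed

text \<open>The swap of the two cylinders keeps tails unchanged, so it maps one set onto the other.\<close>

lemma emeasure_cyl_tail_eq:
  assumes inv: "FC_invariant E \<mu>" and \<mu>: "sets \<mu> = sets (borel_of (path_top E))"
    and pq: "finite_path E p" "finite_path E q" "length p = length q" "tgt (last p) = tgt (last q)"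
  shows "emeasure \<mu> (cyl_tail E F p) = emeasure \<mu> (cyl_tail E F q)"
proof -
  have "swap_cyl E p q \<in> FC E" using FC_swap[OF FC_id pq] by simp
  moreover have "cyl_tail E F p \<in> sets \<mu>"
    unfolding \<mu> by (rule closedin_in_borel_of[OF closedin_cyl_tail])
  ultimately have "emeasure \<mu> (swap_cyl E p q ` cyl_tail E F p) = emeasure \<mu> (cyl_tail E F p)"
    using inv unfolding FC_invariant_def by blast
  moreover have "swap_cyl E p q ` cyl_tail E F p = replace_init q ` cyl_tail E F p"
    by (rule image_cong) (auto simp: swap_cyl_def cyl_tail_def)
  ultimately show ?thesis using replace_init_cyl_tail[OF pq] by simp
qed

section \<open>Counting finite paths\<close>

lemma edges_between_eq: "{e \<in> edges n i. src e = a \<and> tgt e = b} = Edge a b ` {..<mult_entry n i a b}"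
proof (intro set_eqI iffI)
  fix e assume "e \<in> {e \<in> edges n i. src e = a \<and> tgt e = b}"
  then show "e \<in> Edge a b ` {..<mult_entry n i a b}" by (cases e) (auto simp: edges_def)
qed (auto simp: edges_def)

lemma finite_edges_between: "finite {e \<in> edges n i. src e = a \<and> tgt e = b}"
  by (simp add: edges_between_eq)

lemma card_edges_between: "card {e \<in> edges n i. src e = a \<and> tgt e = b} = mult_entry n i a b"
  by (simp add: edges_between_eq card_image inj_on_def)

lemma finite_edges: "finite (edges n i)"
proof -
  have "edges n i = (\<Union>a. \<Union>b. {e \<in> edges n i. src e = a \<and> tgt e = b})" by auto
  moreover have "finite (\<Union>a. \<Union>b. {e \<in> edges n i. src e = a \<and> tgt e = b})"
    by (intro finite_UN_I finite finite_edges_between)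
  ultimately show ?thesis by simp
qed

definition finite_paths_to :: "(nat \<Rightarrow> edge set) \<Rightarrow> nat \<Rightarrow> letter \<Rightarrow> edge list set" where
  "finite_paths_to E k b = {p. finite_path E p \<and> length p = Suc k \<and> tgt (last p) = b}"

lemma finite_paths_to_0:
  "finite_paths_to E 0 b = (\<lambda>e. [e]) ` (\<Union>a. {e \<in> E 0. src e = a \<and> tgt e = b})"
  by (auto simp: finite_paths_to_def finite_path_def length_Suc_conv)

lemma finite_paths_to_Suc:
  "finite_paths_to E (Suc k) b =
    (\<Union>a. (\<lambda>(p, e). p @ [e]) ` (finite_paths_to E k a \<times> {e \<in> E (Suc k). src e = a \<and> tgt e = b}))"
proof (intro set_eqI iffI)
  fix q assume q: "q \<in> finite_paths_to E (Suc k) b"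
  then have "q \<noteq> []" by (auto simp: finite_paths_to_def)
  then obtain p e where pe: "q = p @ [e]" by (cases q rule: rev_cases) auto
  with q have "length p = Suc k" "tgt e = b" "finite_path E (p @ [e])"
    by (auto simp: finite_paths_to_def)
  moreover then have "p \<noteq> []" by auto
  ultimately show "q \<in> (\<Union>a. (\<lambda>(p, e). p @ [e]) `
      (finite_paths_to E k a \<times> {e \<in> E (Suc k). src e = a \<and> tgt e = b}))"
    using finite_path_butlast[of E p e] pe by (auto simp: finite_paths_to_def image_iff)
next
  fix q assume "q \<in> (\<Union>a. (\<lambda>(p, e). p @ [e]) `
      (finite_paths_to E k a \<times> {e \<in> E (Suc k). src e = a \<and> tgt e = b}))"
  then show "q \<in> finite_paths_to E (Suc k) b"
    by (auto simp: finite_paths_to_def intro!: finite_path_append)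
qed

lemma card_finite_paths_to:
  "finite (finite_paths_to (edges n) k b) \<and> card (finite_paths_to (edges n) k b) = path_count n k b"
proof (induction k arbitrary: b)
  case 0
  let ?I = "\<lambda>a. {e \<in> edges n 0. src e = a \<and> tgt e = b}"
  have fin: "finite (\<Union>a. ?I a)" by (intro finite_UN_I finite finite_edges_between)
  have "card (\<Union>a. ?I a) = (\<Sum>a\<in>UNIV. card (?I a))"
    by (intro card_UN_disjoint finite ballI impI finite_edges_between) blast
  also have "\<dots> = path_count n 0 b" by (simp only: card_edges_between path_count.simps)
  finally have "card (\<Union>a. ?I a) = path_count n 0 b" .
  moreover have "card ((\<lambda>e. [e]) ` (\<Union>a. ?I a)) = card (\<Union>a. ?I a)"
    by (intro card_image inj_onI) blast
  ultimately show ?case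
    unfolding finite_paths_to_0 using finite_imageI[OF fin] by simp
next
  case (Suc k)
  let ?I = "\<lambda>a. {e \<in> edges n (Suc k). src e = a \<and> tgt e = b}"
  let ?P = "\<lambda>a. (\<lambda>(p, e). p @ [e]) ` (finite_paths_to (edges n) k a \<times> ?I a)"
  have fin: "finite (?P a)" for a
    by (intro finite_imageI finite_cartesian_product conjunct1[OF Suc.IH] finite_edges_between)
  have "card (?P a) = card (finite_paths_to (edges n) k a \<times> ?I a)" for a
    by (intro card_image inj_onI) auto
  then have card: "card (?P a) = path_count n k a * mult_entry n (Suc k) a b" for a
    using Suc.IH[of a] by (simp only: card_cartesian_product card_edges_between)
  have disj: "?P a \<inter> ?P a' = {}" if "a \<noteq> a'" for a a'
    using that by auto
  have "card (\<Union>a. ?P a) = (\<Sum>a\<in>UNIV. card (?P a))"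
    by (intro card_UN_disjoint finite ballI impI fin disj)
  also have "\<dots> = path_count n (Suc k) b" by (simp only: card path_count.simps)
  finally have "card (\<Union>a. ?P a) = path_count n (Suc k) b" .
  moreover have "finite (\<Union>a. ?P a)" by (intro finite_UN_I finite fin)
  ultimately show ?case unfolding finite_paths_to_Suc by blast
qed

section \<open>The measure of the levels of the tower\<close>

locale tower_measure =
  fixes n nh :: "nat \<Rightarrow> nat" and E :: "nat \<Rightarrow> edge set"
    and \<nu> \<mu> :: "path measure" and w :: "nat \<Rightarrow> real^letter"
  assumes n_pos: "1 \<le> n i" and n_le_nh: "n i \<le> nh i"
    and nested: "nested_edges n nh E"
    and central: "central_measure E \<nu>"
    and eigen: "w \<in> eigen_sequences n" and corr: "corresponds E \<nu> w"
    and ext: "tower_extension (edges nh) E \<nu> \<mu>"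
begin

abbreviation Eh :: "nat \<Rightarrow> edge set" where "Eh \<equiv> edges nh"

abbreviation level_norm :: "nat \<Rightarrow> real" where
  "level_norm k \<equiv> l1norm (mat_prod nh k *v w (Suc k))"

definition level :: "nat \<Rightarrow> path set" where
  "level k = {x \<in> paths Eh. \<forall>i\<in>{k<..}. x i \<in> E i}"

lemma nh_pos: "1 \<le> nh i"
  using n_pos n_le_nh order_trans by blast

lemma E_subset: "E i \<subseteq> Eh i"
  using nested unfolding nested_edges_def by blast

lemma sets_\<mu>: "sets \<mu> = sets (borel_of (path_top Eh))"
  using ext unfolding tower_extension_def by blast

lemma invariant: "FC_invariant Eh \<mu>"
  using ext unfolding tower_extension_def by blast

lemma space_\<mu>: "space \<mu> = paths Eh"
  using sets_eq_imp_space_eq[OF sets_\<mu>] by (simp add: space_borel_of topspace_path_top)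

lemma w_nonneg: "0 \<le> w i $ a"
  by (rule eigen_sequencesD(2)[OF eigen])

lemma cyl_tail_sets: "cyl_tail Eh F p \<in> sets \<mu>"
  unfolding sets_\<mu> by (rule closedin_in_borel_of[OF closedin_cyl_tail])

lemma cyl_sets: "cyl Eh p \<in> sets \<mu>"
  using cyl_tail_sets[of Eh p] by (simp add: cyl_tail_self)

text \<open>The diagonal entries are 1, so there is a path through \<open>b\<close> alone.\<close>

lemma finite_path_E_to: "\<exists>q. finite_path E q \<and> length q = Suc k \<and> tgt (last q) = b"
proof -
  have "mult_entry n i b b = 1" for i by (cases b) auto
  then have "card {e \<in> E i. src e = b \<and> tgt e = b} = 1" for i
    using nested unfolding nested_edges_def by simp
  then have "\<exists>e. e \<in> E i \<and> src e = b \<and> tgt e = b" for i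
    using card_1_singletonE by blast
  then have "\<forall>i. \<exists>e. e \<in> E i \<and> src e = b \<and> tgt e = b" by blast
  from choice[OF this] obtain d
    where d: "\<And>i. d i \<in> E i \<and> src (d i) = b \<and> tgt (d i) = b" by blast
  then have "d \<in> paths E" by (simp add: paths_def)
  then have "finite_path E (map d [0..<Suc k])" by (rule finite_path_initial)
  moreover have "tgt (last (map d [0..<Suc k])) = b" using d by (simp add: last_map)
  ultimately show ?thesis by (intro exI[of _ "map d [0..<Suc k]"]) simp
qed

text \<open>A swap moves \<open>p\<close> to a path \<open>q\<close> of the small system with the same end, and \<open>cyl_tail Eh E q\<close> is the
  cylinder of \<open>q\<close> in the small path space.\<close>

lemma emeasure_cyl_tail:
  assumes p: "finite_path Eh p"
  shows "emeasure \<mu> (cyl_tail Eh E p) = ennreal (w (length p) $ tgt (last p))"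
proof -
  obtain k where k: "length p = Suc k" using p by (cases p) (auto simp: finite_path_def)
  obtain q where q: "finite_path E q" "length q = Suc k" "tgt (last q) = tgt (last p)"
    using finite_path_E_to by blast
  have qh: "finite_path Eh q" using q(1) E_subset unfolding finite_path_def by blast
  have "x \<in> cyl_tail Eh E q \<longleftrightarrow> x \<in> cyl E q" for x
  proof
    assume x: "x \<in> cyl_tail Eh E q"
    have "x i \<in> E i" for i
    proof (cases "i < length q")
      case True
      then have "x i = q ! i" "q ! i \<in> E i"
        using x q(1) by (simp_all add: cyl_tail_def cyl_def finite_path_def)
      then show ?thesis by simp
    next
      case False
      then show ?thesis using x by (simp add: cyl_tail_def)
    qed
    then show "x \<in> cyl E q" using x by (simp add: cyl_tail_def cyl_def paths_def)
  next
    assume x: "x \<in> cyl E q"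
    then have "x i \<in> Eh i" for i using subsetD[OF E_subset[of i]] by (simp add: cyl_def paths_def)
    then show "x \<in> cyl_tail Eh E q" using x by (simp add: cyl_tail_def cyl_def paths_def)
  qed
  then have eq: "cyl_tail Eh E q = cyl E q" by blast
  have "cyl E q \<in> sets \<nu>"
    using central closedin_in_borel_of[OF closedin_cyl] unfolding central_measure_def by blast
  then have "emeasure \<mu> (cyl E q) = emeasure \<nu> (cyl E q)"
    using ext unfolding tower_extension_def by blast
  also have "\<dots> = ennreal (w (length q) $ tgt (last q))"
    using corr q(1) unfolding corresponds_def by blast
  finally show ?thesis
    using emeasure_cyl_tail_eq[OF invariant sets_\<mu> p qh, of E] q k eq by simp
qed

lemma finite_UN_finite_paths_to: "finite (\<Union>b. finite_paths_to Eh k b)"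
  using card_finite_paths_to by auto

lemma paths_cover: "paths Eh = (\<Union>p\<in>(\<Union>b. finite_paths_to Eh k b). cyl Eh p)"
proof (intro set_eqI iffI)
  fix x assume x: "x \<in> paths Eh"
  then have "map x [0..<Suc k] \<in> (\<Union>b. finite_paths_to Eh k b)"
    using finite_path_initial[OF x, of k] by (simp add: finite_paths_to_def)
  moreover have "x \<in> cyl Eh (map x [0..<Suc k])" using x by (simp add: cyl_def del: upt_Suc)
  ultimately show "x \<in> (\<Union>p\<in>(\<Union>b. finite_paths_to Eh k b). cyl Eh p)" by blast
qed (auto simp: cyl_def)

lemma emeasure_level: "emeasure \<mu> (level k) = ennreal (level_norm k)"
proof -
  let ?I = "\<Union>b. finite_paths_to Eh k b"
  have "level k = (\<Union>p\<in>?I. cyl_tail Eh E p)"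
  proof -
    have "cyl_tail Eh E p = cyl Eh p \<inter> level k" if "p \<in> ?I" for p
      using that by (auto simp: cyl_tail_def level_def cyl_def finite_paths_to_def Suc_le_eq)
    moreover have "level k = (\<Union>p\<in>?I. cyl Eh p) \<inter> level k"
      using paths_cover[of k] by (auto simp: level_def)
    ultimately show ?thesis by auto
  qed
  also have "emeasure \<mu> \<dots> = (\<Sum>p\<in>?I. emeasure \<mu> (cyl_tail Eh E p))"
  proof (rule sum_emeasure[symmetric])
    show "(cyl_tail Eh E) ` ?I \<subseteq> sets \<mu>" using cyl_tail_sets by blast
    show "finite ?I" by (rule finite_UN_finite_paths_to)
    show "disjoint_family_on (cyl_tail Eh E) ?I"
      unfolding disjoint_family_on_def
    proof (intro ballI impI equals0I)
      fix p q x assume "p \<in> ?I" "q \<in> ?I" "p \<noteq> q" "x \<in> cyl_tail Eh E p \<inter> cyl_tail Eh E q"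
      moreover then have "p = q"
        by (intro nth_equalityI) (auto simp: cyl_tail_def cyl_def finite_paths_to_def)
      ultimately show False by blast
    qed
  qed
  also have "\<dots> = (\<Sum>p\<in>?I. ennreal (w (Suc k) $ tgt (last p)))"
    using emeasure_cyl_tail by (intro sum.cong) (auto simp: finite_paths_to_def)
  also have "\<dots> = (\<Sum>b\<in>UNIV. \<Sum>p\<in>finite_paths_to Eh k b. ennreal (w (Suc k) $ tgt (last p)))"
    using card_finite_paths_to
    by (intro sum.UNION_disjoint) (auto simp: finite_paths_to_def)
  also have "\<dots> = (\<Sum>b\<in>UNIV. \<Sum>p\<in>finite_paths_to Eh k b. ennreal (w (Suc k) $ b))"
    by (intro sum.cong) (auto simp: finite_paths_to_def)
  also have "\<dots> = (\<Sum>b\<in>UNIV. ennreal (real (path_count nh k b) * w (Suc k) $ b))"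
    using card_finite_paths_to w_nonneg by (simp add: ennreal_mult' ennreal_of_nat_eq_real_of_nat)
  also have "\<dots> = ennreal (\<Sum>b\<in>UNIV. real (path_count nh k b) * w (Suc k) $ b)"
    using w_nonneg by (intro sum_ennreal) simp
  finally show ?thesis using l1norm_mat_prod[OF w_nonneg] by simp
qed

lemma level_sets: "level k \<in> sets \<mu>"
  unfolding sets_\<mu> level_def by (rule closedin_in_borel_of[OF closedin_path_coords])

lemma incseq_level: "incseq level"
  by (auto simp: incseq_def level_def)

lemma tower_eq: "tower Eh E = (\<Union>k. level k)"
proof (intro set_eqI iffI)
  fix x assume "x \<in> tower Eh E"
  then obtain k where "\<forall>i\<in>{i. x i \<notin> E i}. i \<le> k" "x \<in> paths Eh"
    unfolding tower_def finite_nat_set_iff_bounded_le by blast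
  then have "x \<in> level k" by (auto simp: level_def)
  then show "x \<in> (\<Union>k. level k)" by blast
next
  fix x assume "x \<in> (\<Union>k. level k)"
  then obtain k where "x \<in> level k" by blast
  then have "{i. x i \<notin> E i} \<subseteq> {..k}" "x \<in> paths Eh" by (auto simp: level_def not_less[symmetric])
  then show "x \<in> tower Eh E" unfolding tower_def using finite_subset by blast
qed

lemma null_outside_levels: "emeasure \<mu> (paths Eh - (\<Union>k. level k)) = 0"
  using ext unfolding tower_extension_def tower_eq by blast

lemma emeasure_space: "emeasure \<mu> (space \<mu>) = (SUP k. ennreal (level_norm k))"
proof -
  have "emeasure \<mu> (space \<mu>) = emeasure \<mu> (\<Union>k. level k)"
  proof -
    have "(\<Union>k. level k) \<in> sets \<mu>" using level_sets by auto
    moreover have "space \<mu> - (\<Union>k. level k) \<in> null_sets \<mu>"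
      using level_sets null_outside_levels by (auto simp: null_sets_def space_\<mu>[symmetric])
    moreover have "space \<mu> = (\<Union>k. level k) \<union> (space \<mu> - (\<Union>k. level k))"
      using space_\<mu> by (auto simp: level_def)
    ultimately show ?thesis using emeasure_Un_null_set by metis
  qed
  also have "\<dots> = (SUP k. emeasure \<mu> (level k))"
    using level_sets incseq_level by (subst SUP_emeasure_incseq) auto
  finally show ?thesis by (simp add: emeasure_level)
qed

lemma inner_regular: "inner_regular_in (path_top Eh) \<mu>"
proof -
  obtain \<phi> :: "path \<Rightarrow> nat \<Rightarrow> real" where \<phi>:
    "continuous_map (path_top Eh) euclidean \<phi>" "inj_on \<phi> (topspace (path_top Eh))"
    by (rule path_top_embedding)
  show ?thesis
    using inner_regular_in_sigma_finite[OF compact_space_path_top[of Eh, OF finite_edges] \<phi> sets_\<mu>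
        level_sets incseq_level] emeasure_level null_outside_levels
    by (simp add: topspace_path_top)
qed

lemma level_norm_nonneg: "0 \<le> level_norm k"
  by (simp add: l1norm_def sum_nonneg)

text \<open>The norms are the measures of increasing sets, so their lower limit is their supremum.\<close>

lemma finite_measure_iff: "finite_measure \<mu> \<longleftrightarrow> liminf (\<lambda>k. ereal (level_norm k)) < \<infinity>"
proof -
  have inc: "incseq level_norm"
  proof (rule incseq_SucI)
    fix k
    have "emeasure \<mu> (level k) \<le> emeasure \<mu> (level (Suc k))"
      using level_sets incseqD[OF incseq_level, of k "Suc k"] by (intro emeasure_mono) auto
    then show "level_norm k \<le> level_norm (Suc k)"
      unfolding emeasure_level by (subst (asm) ennreal_le_iff) (rule level_norm_nonneg)
  qed
  have "finite_measure \<mu> \<longleftrightarrow> (\<exists>C. \<forall>k. level_norm k \<le> C)"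
  proof
    assume "finite_measure \<mu>"
    then interpret finite_measure \<mu> .
    have "ennreal (level_norm k) \<le> ennreal (measure \<mu> (space \<mu>))" for k
      unfolding emeasure_eq_measure[symmetric] emeasure_space by (rule SUP_upper) simp
    then show "\<exists>C. \<forall>k. level_norm k \<le> C" by (auto simp: ennreal_le_iff)
  next
    assume "\<exists>C. \<forall>k. level_norm k \<le> C"
    then obtain C where C: "\<And>k. level_norm k \<le> C" by blast
    have "emeasure \<mu> (space \<mu>) \<le> ennreal C"
      unfolding emeasure_space using C by (intro SUP_least ennreal_leI)
    then show "finite_measure \<mu>" by (intro finite_measureI) (auto simp: top_unique)
  qed
  then show ?thesis using liminf_incseq_finite_iff[OF inc] by simp
qed

lemma liminf_level_norm_iff:
  "liminf (\<lambda>k. ereal (level_norm k)) < \<infinity> \<longleftrightarrow> liminf (\<lambda>k. ereal (lam_prod nh k / lam_prod n k)) < \<infinity>"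
proof -
  obtain C where C: "0 < C"
    "\<And>k. C * (lam_prod nh k / lam_prod n k) \<le> level_norm k"
    "\<And>k. level_norm k \<le> 4 * C * (lam_prod nh k / lam_prod n k)"
    using l1norm_eigen_sequence_comparable[of nh n w, OF nh_pos n_pos eigen] by blast
  have C': "lam_prod nh k / lam_prod n k \<le> 1 / C * level_norm k" for k
    using C(1) C(2)[of k] by (simp add: field_simps)
  show ?thesis
  proof
    assume "liminf (\<lambda>k. ereal (level_norm k)) < \<infinity>"
    then show "liminf (\<lambda>k. ereal (lam_prod nh k / lam_prod n k)) < \<infinity>"
      using C(1) by (intro liminf_finite_le[OF C']) simp_all
  next
    assume "liminf (\<lambda>k. ereal (lam_prod nh k / lam_prod n k)) < \<infinity>"
    then show "liminf (\<lambda>k. ereal (level_norm k)) < \<infinity>"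
      using C(1) by (intro liminf_finite_le[OF C(3)]) simp_all
  qed
qed

section \<open>The infinite case\<close>

text \<open>The product of two consecutive matrices has positive entries, as they are triangular of opposite
  kinds.\<close>

lemma two_edge_path:
  obtains e f where "e \<in> Eh i" "f \<in> Eh (Suc i)" "src e = a" "tgt e = src f" "tgt f = b"
proof -
  have "0 < nh i" "0 < nh (Suc i)" using nh_pos[of i] nh_pos[of "Suc i"] by auto
  then have "\<exists>c. 0 < mult_entry nh i a c \<and> 0 < mult_entry nh (Suc i) c b"
    by (cases a; cases b; cases "even i") (auto intro: exI[of _ A] exI[of _ B])
  then obtain c where "0 < mult_entry nh i a c" "0 < mult_entry nh (Suc i) c b" by blast
  then show ?thesis by (intro that[of "Edge a c 0" "Edge c b 0"]) (auto simp: edges_def)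
qed

text \<open>Among the finitely many cylinders that are two edges longer than \<open>p\<close> one has infinite measure, and
  \<open>p\<close> can be prolonged to end in the same letter.\<close>

lemma emeasure_cyl_infinite:
  assumes inf: "\<not> finite_measure \<mu>" and p: "finite_path Eh p"
  shows "emeasure \<mu> (cyl Eh p) = \<infinity>"
proof -
  let ?I = "\<Union>b. finite_paths_to Eh (Suc (length p)) b"
  have "emeasure \<mu> (space \<mu>) = \<infinity>" using inf finite_measureI[of \<mu>] by blast
  moreover have "emeasure \<mu> (space \<mu>) \<le> (\<Sum>q\<in>?I. emeasure \<mu> (cyl Eh q))"
    unfolding space_\<mu> paths_cover[of "Suc (length p)"]
    by (intro emeasure_subadditive_finite finite_UN_finite_paths_to image_subsetI cyl_sets)
  ultimately have "(\<Sum>q\<in>?I. emeasure \<mu> (cyl Eh q)) = \<infinity>" by (simp add: top_unique)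
  then obtain q where q: "q \<in> ?I" "emeasure \<mu> (cyl Eh q) = \<infinity>"
    using finite_UN_finite_paths_to by (auto simp: ennreal_sum_eq_top)
  obtain e f where ef: "e \<in> Eh (length p)" "f \<in> Eh (Suc (length p))" "src e = tgt (last p)"
    "tgt e = src f" "tgt f = tgt (last q)"
    by (rule two_edge_path)
  have "finite_path Eh (p @ [e])" using finite_path_append[OF p] ef by simp
  from finite_path_append[OF this, of f] have r: "finite_path Eh ((p @ [e]) @ [f])"
    using ef by simp
  have "emeasure \<mu> (cyl Eh q) = emeasure \<mu> (cyl Eh ((p @ [e]) @ [f]))"
  proof -
    have "finite_path Eh q" "length q = length ((p @ [e]) @ [f])"
      "tgt (last q) = tgt (last ((p @ [e]) @ [f]))"
      using q(1) ef(5) by (simp_all add: finite_paths_to_def)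
    from emeasure_cyl_tail_eq[OF invariant sets_\<mu> this(1) r this(2,3), of Eh]
    show ?thesis unfolding cyl_tail_self .
  qed
  also have "\<dots> \<le> emeasure \<mu> (cyl Eh p)"
    by (intro emeasure_mono cyl_sets) (auto simp: cyl_def nth_append)
  finally show ?thesis using q(2) by (simp add: top_unique)
qed

lemma emeasure_open_infinite:
  assumes inf: "\<not> finite_measure \<mu>" and U: "openin (path_top Eh) U" "U \<noteq> {}"
  shows "emeasure \<mu> U = \<infinity>"
proof -
  obtain x where x: "x \<in> U" using U(2) by blast
  then have "x \<in> paths Eh" using openin_subset[OF U(1)] by (auto simp: topspace_path_top)
  then have path: "finite_path Eh (map x [0..<Suc m])" for m by (rule finite_path_initial)
  obtain m where "cyl Eh (map x [0..<Suc m]) \<subseteq> U" by (rule open_contains_cyl[OF U(1) x])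
  then have "emeasure \<mu> (cyl Eh (map x [0..<Suc m])) \<le> emeasure \<mu> U"
    using openin_in_borel_of[OF U(1)] sets_\<mu> by (intro emeasure_mono) auto
  then show ?thesis using emeasure_cyl_infinite[OF inf path] by (simp add: top_unique)
qed

lemma not_radon:
  assumes inf: "\<not> finite_measure \<mu>"
  shows "\<not> radon_in (path_top Eh) \<mu>"
proof
  assume "radon_in (path_top Eh) \<mu>"
  then have lf: "locally_finite_in (path_top Eh) \<mu>" by (simp add: radon_in_def)
  have "space \<mu> \<noteq> {}"
  proof
    assume "space \<mu> = {}"
    then have "emeasure \<mu> (space \<mu>) \<noteq> \<infinity>" by simp
    then show False using inf finite_measureI[of \<mu>] by blast
  qed
  then obtain x where "x \<in> topspace (path_top Eh)" by (auto simp: space_\<mu> topspace_path_top)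
  then obtain U where "openin (path_top Eh) U" "x \<in> U" "emeasure \<mu> U < \<infinity>"
    using lf unfolding locally_finite_in_def by blast
  then show False using emeasure_open_infinite[OF inf, of U] by force
qed

section \<open>The measure on the circle\<close>

lemma coding_measurable:
  assumes "standard_coding nh \<pi>"
  shows "\<pi> \<in> borel_measurable \<mu>"
  using assms continuous_map_borel_measurable[OF sets_\<mu>] unfolding standard_coding_def by blast

lemma inner_regular_circle:
  assumes "standard_coding nh \<pi>"
  shows "inner_regular_in euclidean (distr \<mu> borel \<pi>)"
  using inner_regular_in_distr[OF inner_regular sets_\<mu> _ Hausdorff_space_circle] assms
  unfolding standard_coding_def by blast

lemma emeasure_open_infinite_circle:
  assumes inf: "\<not> finite_measure \<mu>" and \<pi>: "standard_coding nh \<pi>" and U: "open U" "U \<noteq> {}"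
  shows "emeasure (distr \<mu> borel \<pi>) U = \<infinity>"
proof -
  let ?V = "{x \<in> topspace (path_top Eh). \<pi> x \<in> U}"
  have cont: "continuous_map (path_top Eh) euclidean \<pi>" and surj: "\<pi> ` paths Eh = UNIV"
    using \<pi> unfolding standard_coding_def by auto
  have "openin (path_top Eh) ?V"
    using openin_continuous_map_preimage[OF cont, of U] U(1) by simp
  moreover have "?V \<noteq> {}"
  proof -
    obtain u where u: "u \<in> U" using U(2) by blast
    then obtain x where "x \<in> paths Eh" "u = \<pi> x" using surj by blast
    then show ?thesis using u by (auto simp: topspace_path_top)
  qed
  ultimately have "emeasure \<mu> ?V = \<infinity>" by (rule emeasure_open_infinite[OF inf])
  moreover have "\<pi> -` U \<inter> space \<mu> = ?V" by (auto simp: space_\<mu> topspace_path_top)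
  ultimately show ?thesis
    using coding_measurable[OF \<pi>] U(1) by (simp add: emeasure_distr)
qed

lemma not_radon_circle:
  assumes inf: "\<not> finite_measure \<mu>" and \<pi>: "standard_coding nh \<pi>"
  shows "\<not> radon_in euclidean (distr \<mu> borel \<pi>)"
proof
  assume "radon_in euclidean (distr \<mu> borel \<pi>)"
  then obtain U where "open U" "abs_circle 0 \<in> U" "emeasure (distr \<mu> borel \<pi>) U < \<infinity>"
    unfolding radon_in_def locally_finite_in_def by (auto simp flip: open_openin)
  then show False using emeasure_open_infinite_circle[OF inf \<pi>, of U] by force
qed

end

section \<open>Finiteness and local behaviour of the tower measure\<close>

theorem theorem5p19:
  fixes n nh :: "nat \<Rightarrow> nat" and E :: "nat \<Rightarrow> edge set"
    and \<nu> \<nu>h :: "path measure" and w :: "nat \<Rightarrow> real^letter"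
  assumes "\<And>i. 1 \<le> n i" and "\<And>i. n i \<le> nh i"
    and "nested_edges n nh E"
    and "central_measure E \<nu>"
    and "w \<in> eigen_sequences n" and "corresponds E \<nu> w"
    and "tower_extension (edges nh) E \<nu> \<nu>h"
  shows "inner_regular_in (path_top (edges nh)) \<nu>h
    \<and> (finite_measure \<nu>h \<longleftrightarrow>
         liminf (\<lambda>k. ereal (l1norm (mat_prod nh k *v w (Suc k)))) < \<infinity>)
    \<and> (liminf (\<lambda>k. ereal (l1norm (mat_prod nh k *v w (Suc k)))) < \<infinity> \<longleftrightarrow>
         liminf (\<lambda>k. ereal (lam_prod nh k / lam_prod n k)) < \<infinity>)
    \<and> (\<not> finite_measure \<nu>h \<longrightarrow>
         (\<forall>U. openin (path_top (edges nh)) U \<and> U \<noteq> {} \<longrightarrow> emeasure \<nu>h U = \<infinity>)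
         \<and> \<not> radon_in (path_top (edges nh)) \<nu>h)
    \<and> (\<forall>\<pi>. standard_coding nh \<pi> \<longrightarrow>
         inner_regular_in euclidean (distr \<nu>h borel \<pi>)
         \<and> (\<not> finite_measure \<nu>h \<longrightarrow>
              (\<forall>U. open U \<and> U \<noteq> {} \<longrightarrow> emeasure (distr \<nu>h borel \<pi>) U = \<infinity>)
              \<and> \<not> radon_in euclidean (distr \<nu>h borel \<pi>)))"
proof -
  interpret tower_measure n nh E \<nu> \<nu>h w using assms by unfold_locales
  show ?thesis
    by (intro conjI allI impI inner_regular finite_measure_iff liminf_level_norm_iff not_radon
        inner_regular_circle not_radon_circle)
      (auto intro: emeasure_open_infinite emeasure_open_infinite_circle simp del: infinity_ennreal_def)
qed

end
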